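(* Let $\mathbf{X}=(X_1,\ldots,X_N)^\intercal:(\Omega,\mathcal{F})\to(\mathbb{A}^N,\mathcal{B}^N)$ be a vector of $N\in\mathbb{N}$ input random variables satisfying the standing assumptions (1)-(3) listed in the context. Let a degree $\mathbf{p}=(p_1,\ldots,p_N)\in\mathbb{N}_0^N$ and a family of knot sequences $\boldsymbol{\Xi}=\{\boldsymbol{\xi}_1,\ldots,\boldsymbol{\xi}_N\}$ be specified, where $\boldsymbol{\xi}_k$ is a $(p_k+1)$-open knot sequence on $[a_k,b_k]$, and for $\emptyset\neq u\subseteq\{1,\ldots,N\}$ let $\{\Psi^u_{\mathbf{i}_u,\mathbf{p}_u,\boldsymbol{\Xi}_u}(\mathbf{X}_u):\mathbf{i}_u\in\bar{\mathcal{I}}_{u,\mathbf{n}_u}\}$ be the reduced set of multivariate orthonormal B-splines consistent with the probability measure $f_{\mathbf{X}_u}(\mathbf{x}_u)\,d\mathbf{x}_u$. Then, for any random variable $y(\mathbf{X})\in L^2(\Omega,\mathcal{F},\mathbb{P})$, the SDD approximation of $y(\mathbf{X})$, i.e. the orthogonal projection $y_{\mathbf{p},\boldsymbol{\Xi}}(\mathbf{X})$ of $y(\mathbf{X})$ onto the spline space $\mathcal{S}_{\mathbf{p},\boldsymbol{\Xi}}$, is given by \[ y_{\mathbf{p},\boldsymbol{\Xi}}(\mathbf{X}) = y_\emptyset+\sum_{\emptyset\neq u\subseteq\{1,\ldots,N\}}\ \sum_{\mathbf{i}_u\in\bar{\mathcal{I}}_{u,\mathbf{n}_u}} C^u_{\mathbf{i}_u,\mathbf{p}_u,\boldsymbol{\Xi}_u}\,\Psi^u_{\mathbf{i}_u,\mathbf{p}_u,\boldsymbol{\Xi}_u}(\mathbf{X}_u),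 \] where the expansion coefficients $y_\emptyset\in\mathbb{R}$ and $C^u_{\mathbf{i}_u,\mathbf{p}_u,\boldsymbol{\Xi}_u}\in\mathbb{R}$ are \[ y_\emptyset=\mathbb{E}[y(\mathbf{X})]=\int_{\mathbb{A}^N}y(\mathbf{x})f_{\mathbf{X}}(\mathbf{x})\,d\mathbf{x}, \] \[ C^u_{\mathbf{i}_u,\mathbf{p}_u,\boldsymbol{\Xi}_u}=\mathbb{E}\left[y(\mathbf{X})\Psi^u_{\mathbf{i}_u,\mathbf{p}_u,\boldsymbol{\Xi}_u}(\mathbf{X}_u)\right]=\int_{\mathbb{A}^N}y(\mathbf{x})\Psi^u_{\mathbf{i}_u,\mathbf{p}_u,\boldsymbol{\Xi}_u}(\mathbf{x}_u)f_{\mathbf{X}}(\mathbf{x})\,d\mathbf{x},\qquad \mathbf{i}_u\in\bar{\mathcal{I}}_{u,\mathbf{n}_u}. \]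
   Context: Notation: $\mathbb{N}=\{1,2,\ldots\}$, $\mathbb{N}_0=\mathbb{N}\cup\{0\}$. $(\Omega,\mathcal{F},\mathbb{P})$ is a probability space with expectation $\mathbb{E}$; for $k=1,\ldots,N$, $[a_k,b_k]\subset\mathbb{R}$ is a finite interval with $a_k<b_k$; $\mathbb{A}^N=\prod_{k=1}^N[a_k,b_k]$ with Borel $\sigma$-algebra $\mathcal{B}^N$. Standing assumptions on $\mathbf{X}$: (1) $X_1,\ldots,X_N$ are statistically independent, not necessarily identically distributed. (2) Each $X_k$ is defined on the bounded interval $[a_k,b_k]$, hence has finite moments of all orders. (3) Each $X_k$ has an absolutely continuous marginal distribution function and a continuous marginal probability density function $f_{X_k}$ with bounded support $[a_k,b_k]$. Hence $\mathbf{X}$ has joint density $f_{\mathbf{X}}(\mathbf{x})=\prod_{k=1}^N f_{X_k}(x_k)$ supported on $\mathbb{A}^N$. For $\emptyset\neq u=\{k_1,\ldots,k_{|u|}\}\subseteq\{1,\ldots,N\}$: $\mathbf{X}_u=(X_{k_1},\ldots,X_{k_{|u|}})^\intercal$, $\mathbf{x}_u=(x_{k_1},\ldots,x_{k_{|u|}})$, $f_{\mathbf{X}_u}(\mathbf{x}_u)=\prod_{k\in u}f_{X_k}(x_k)$, $\mathbf{p}_u=(p_k)_{k\in u}$, $\boldsymbol{\Xi}_u=\{\boldsymbol{\xi}_k\}_{k\in u}$, $\mathbf{n}_u=(n_k)_{k\in u}$. Knots: for $n_k>p_k\ge0$, a $(p_k+1)$-open knot sequence on $[a_k,b_k]$ is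 a non-decreasing sequence $\boldsymbol{\xi}_k=\{\xi_{k,i}\}_{i=1}^{n_k+p_k+1}$ with distinct values $a_k=\zeta_{k,1}<\cdots<\zeta_{k,r_k}=b_k$ of multiplicities $m_{k,1}=m_{k,r_k}=p_k+1$ and $1\le m_{k,j}\le p_k+1$ for $1<j<r_k$. B-splines: $B^k_{i,0,\boldsymbol{\xi}_k}(x)=1$ if $\xi_{k,i}\le x<\xi_{k,i+1}$ and $0$ otherwise; for $p\ge1$, $B^k_{i,p,\boldsymbol{\xi}_k}(x)=\frac{x-\xi_{k,i}}{\xi_{k,i+p}-\xi_{k,i}}B^k_{i,p-1,\boldsymbol{\xi}_k}(x)+\frac{\xi_{k,i+p+1}-x}{\xi_{k,i+p+1}-\xi_{k,i+1}}B^k_{i+1,p-1,\boldsymbol{\xi}_k}(x)$, with $0/0:=0$. The univariate spline space is $\mathcal{S}_{k,p_k,\boldsymbol{\xi}_k}=\operatorname{span}\{B^k_{i,p_k,\boldsymbol{\xi}_k}:1\le i\le n_k\}$, of dimension $n_k$. Functions equal almost everywhere are identified. Orthonormalized B-splines: let $\mathbf{P}_k(x_k)=(1,B^k_{2,p_k,\boldsymbol{\xi}_k}(x_k),\ldots,B^k_{n_k,p_k,\boldsymbol{\xi}_k}(x_k))^\intercal$, let $\mathbf{G}_k=\mathbb{E}[\mathbf{P}_k(X_k)\mathbf{P}_k^\intercal(X_k)]$ (symmetric positive-definite), with Cholesky factorization $\mathbf{G}_k=\mathbf{Q}_k\mathbf{Q}_k^\intercal$, $\mathbf{Q}_k$ lower-triangular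 with positive diagonal. Then $\boldsymbol{\psi}_k(x_k)=\mathbf{Q}_k^{-1}\mathbf{P}_k(x_k)$ has components $\psi^k_{i,p_k,\boldsymbol{\xi}_k}(x_k)$, $i=1,\ldots,n_k$. Multivariate splines: $\bar{\mathcal{I}}_{u,\mathbf{n}_u}=\{\mathbf{i}_u=(i_{k_1},\ldots,i_{k_{|u|}}):2\le i_{k_l}\le n_{k_l},\ 1\le l\le|u|\}$ and $\Psi^u_{\mathbf{i}_u,\mathbf{p}_u,\boldsymbol{\Xi}_u}(\mathbf{x}_u)=\prod_{k\in u}\psi^k_{i_k,p_k,\boldsymbol{\xi}_k}(x_k)$. The tensor-product spline space is $\mathcal{S}_{\mathbf{p},\boldsymbol{\Xi}}=\bigotimes_{k=1}^N\mathcal{S}_{k,p_k,\boldsymbol{\xi}_k}$, regarded both as a space of functions of $\mathbf{x}$ in $L^2(\mathbb{A}^N,\mathcal{B}^N,f_{\mathbf{X}}d\mathbf{x})$ and, by substituting $\mathbf{X}$ for $\mathbf{x}$, as a space of random variables in $L^2(\Omega,\mathcal{F},\mathbb{P})$. $L^2(\mathbb{A}^N,\mathcal{B}^N,f_{\mathbf{X}}d\mathbf{x})$ is the space of real functions $y$ with $\int_{\mathbb{A}^N}|y|^2f_{\mathbf{X}}d\mathbf{x}<\infty$; here $L^2(\Omega,\mathcal{F},\mathbb{P})$ denotes the corresponding Hilbert space of square-integrable random variables of the form $y(\mathbf{X})$, with inner product $\mathbb{E}[y(\mathbf{X})z(\mathbf{X})]$. *)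

theory Defs
  imports
    "HOL-Probability.Probability"
    "HOL-Library.Function_Algebras"
    "Jordan_Normal_Form.Gauss_Jordan_Elimination"
begin

section \<open>Knot sequences and B-splines\<close>

text \<open>
  Sequences are indexed from 1, as in the mathematical text; values outside the stated index range
  are irrelevant.
\<close>

definition knot_mult :: "nat \<Rightarrow> nat \<Rightarrow> (nat \<Rightarrow> real) \<Rightarrow> real \<Rightarrow> nat" where
  "knot_mult p n \<xi> z = card {i \<in> {1..n + p + 1}. \<xi> i = z}"

definition open_knot_sequence :: "nat \<Rightarrow> nat \<Rightarrow> real \<Rightarrow> real \<Rightarrow> (nat \<Rightarrow> real) \<Rightarrow> bool" where
  "open_knot_sequence p n a b \<xi> \<longleftrightarrow>
     p < n \<and> mono_on {1..n + p + 1} \<xi> \<and>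
     (\<exists>(r :: nat) (\<zeta> :: nat \<Rightarrow> real). 1 \<le> r \<and> strict_mono_on {1..r} \<zeta> \<and> \<zeta> 1 = a \<and> \<zeta> r = b \<and>
        \<xi> ` {1..n + p + 1} = \<zeta> ` {1..r} \<and>
        knot_mult p n \<xi> (\<zeta> 1) = p + 1 \<and> knot_mult p n \<xi> (\<zeta> r) = p + 1 \<and>
        (\<forall>j. 1 < j \<and> j < r \<longrightarrow> 1 \<le> knot_mult p n \<xi> (\<zeta> j) \<and> knot_mult p n \<xi> (\<zeta> j) \<le> p + 1))"

text \<open>The convention \<open>0/0 = 0\<close> is the library's \<open>x / 0 = 0\<close>.\<close>

fun bspline :: "nat \<Rightarrow> nat \<Rightarrow> (nat \<Rightarrow> real) \<Rightarrow> real \<Rightarrow> real" where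
  "bspline i 0 \<xi> x = (if \<xi> i \<le> x \<and> x < \<xi> (i + 1) then 1 else 0)"
| "bspline i (Suc p) \<xi> x =
     (x - \<xi> i) / (\<xi> (i + Suc p) - \<xi> i) * bspline i p \<xi> x
     + (\<xi> (i + Suc p + 1) - x) / (\<xi> (i + Suc p + 1) - \<xi> (i + 1)) * bspline (i + 1) p \<xi> x"


section \<open>Spline spaces\<close>

global_interpretation fun_space: vector_space "\<lambda>(c::real) (g :: 'a \<Rightarrow> real) x. c * g x"
  by unfold_locales (auto simp: fun_eq_iff algebra_simps)

definition spline_space :: "nat \<Rightarrow> nat \<Rightarrow> (nat \<Rightarrow> real) \<Rightarrow> (real \<Rightarrow> real) set" where
  "spline_space p n \<xi> = fun_space.span {bspline i p \<xi> | i. i \<in> {1..n}}"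

text \<open>The tensor product of spaces of functions, realized as the span of the product functions.\<close>

definition tensor_spline_space ::
    "nat \<Rightarrow> (nat \<Rightarrow> nat) \<Rightarrow> (nat \<Rightarrow> nat) \<Rightarrow> (nat \<Rightarrow> nat \<Rightarrow> real) \<Rightarrow> ((nat \<Rightarrow> real) \<Rightarrow> real) set" where
  "tensor_spline_space N p n \<xi> =
     fun_space.span {\<lambda>x. \<Prod>k\<in>{1..N}. g k (x k) | g. \<forall>k\<in>{1..N}. g k \<in> spline_space (p k) (n k) (\<xi> k)}"


section \<open>Orthonormalized B-splines\<close>

text \<open>
  Matrices and vectors of the library are indexed from 0, so entry \<open>i\<close> below belongs to the
  B-spline with index \<open>i + 1\<close>.
\<close>

definition P_vec :: "nat \<Rightarrow> nat \<Rightarrow> (nat \<Rightarrow> real) \<Rightarrow> real \<Rightarrow> real Matrix.vec" where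
  "P_vec p n \<xi> x = Matrix.vec n (\<lambda>i. if i = 0 then 1 else bspline (i + 1) p \<xi> x)"

definition gram_mat :: "'w measure \<Rightarrow> ('w \<Rightarrow> real) \<Rightarrow> nat \<Rightarrow> nat \<Rightarrow> (nat \<Rightarrow> real) \<Rightarrow> real Matrix.mat" where
  "gram_mat M X p n \<xi> = Matrix.mat n n (\<lambda>(i, j).
     prob_space.expectation M (\<lambda>\<omega>. vec_index (P_vec p n \<xi> (X \<omega>)) i * vec_index (P_vec p n \<xi> (X \<omega>)) j))"

definition is_cholesky_factor :: "real Matrix.mat \<Rightarrow> real Matrix.mat \<Rightarrow> bool" where
  "is_cholesky_factor G Q \<longleftrightarrow>
     Q \<in> carrier_mat (dim_row G) (dim_row G) \<and>
     (\<forall>i < dim_row G. \<forall>j < dim_row G. i < j \<longrightarrow> Q $$ (i, j) = 0) \<and>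
     (\<forall>i < dim_row G. 0 < Q $$ (i, i)) \<and>
     G = Q * transpose_mat Q"

text \<open>Unique for symmetric positive-definite matrices.\<close>

definition cholesky :: "real Matrix.mat \<Rightarrow> real Matrix.mat" where
  "cholesky G = (THE Q. is_cholesky_factor G Q)"

definition ortho_spline ::
    "'w measure \<Rightarrow> ('w \<Rightarrow> real) \<Rightarrow> nat \<Rightarrow> nat \<Rightarrow> (nat \<Rightarrow> real) \<Rightarrow> nat \<Rightarrow> real \<Rightarrow> real" where
  "ortho_spline M X p n \<xi> i x =
     vec_index (the (mat_inverse (cholesky (gram_mat M X p n \<xi>))) *\<^sub>v P_vec p n \<xi> x) (i - 1)"

definition multi_ortho_spline ::
    "'w measure \<Rightarrow> (nat \<Rightarrow> 'w \<Rightarrow> real) \<Rightarrow> (nat \<Rightarrow> nat) \<Rightarrow> (nat \<Rightarrow> nat) \<Rightarrow> (nat \<Rightarrow> nat \<Rightarrow> real)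
      \<Rightarrow> nat set \<Rightarrow> (nat \<Rightarrow> nat) \<Rightarrow> (nat \<Rightarrow> real) \<Rightarrow> real" where
  "multi_ortho_spline M X p n \<xi> u i x =
     (\<Prod>k\<in>u. ortho_spline M (X k) (p k) (n k) (\<xi> k) (i k) (x k))"

definition reduced_index_set :: "(nat \<Rightarrow> nat) \<Rightarrow> nat set \<Rightarrow> (nat \<Rightarrow> nat) set" where
  "reduced_index_set n u = (\<Pi>\<^sub>E k\<in>u. {2..n k})"


section \<open>Random vectors, square-integrability and orthogonal projection\<close>

definition box_set :: "nat \<Rightarrow> (nat \<Rightarrow> real) \<Rightarrow> (nat \<Rightarrow> real) \<Rightarrow> (nat \<Rightarrow> real) set" where
  "box_set N a b = (\<Pi>\<^sub>E k\<in>{1..N}. {a k..b k})"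

definition box_borel :: "nat \<Rightarrow> (nat \<Rightarrow> real) \<Rightarrow> (nat \<Rightarrow> real) \<Rightarrow> (nat \<Rightarrow> real) measure" where
  "box_borel N a b = restrict_space (\<Pi>\<^sub>M k\<in>{1..N}. borel) (box_set N a b)"

definition rand_vec :: "nat \<Rightarrow> (nat \<Rightarrow> 'w \<Rightarrow> real) \<Rightarrow> 'w \<Rightarrow> nat \<Rightarrow> real" where
  "rand_vec N X \<omega> = (\<lambda>k\<in>{1..N}. X k \<omega>)"

definition joint_density :: "nat \<Rightarrow> (nat \<Rightarrow> real \<Rightarrow> real) \<Rightarrow> (nat \<Rightarrow> real) \<Rightarrow> real" where
  "joint_density N f x = (\<Prod>k\<in>{1..N}. f k (x k))"

definition square_integrable :: "'w measure \<Rightarrow> ('w \<Rightarrow> real) \<Rightarrow> bool" where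
  "square_integrable M Y \<longleftrightarrow> Y \<in> borel_measurable M \<and> integrable M (\<lambda>\<omega>. (Y \<omega>)\<^sup>2)"

text \<open>
  \<open>Z\<close> is a representative of the orthogonal projection of \<open>Y\<close> onto the subspace \<open>S\<close> of \<open>L\<^sup>2\<close>:
  up to almost sure equality it lies in \<open>S\<close>, and \<open>Y - Z\<close> is orthogonal to \<open>S\<close>. Membership is
  required only almost surely because \<open>L\<^sup>2\<close> functions are identified when equal almost everywhere
  (for instance, the B-splines sum to 1 on the half-open interval only, so the constant 1 is in the
  spline space only almost everywhere).
\<close>

definition is_orth_projection ::
    "'w measure \<Rightarrow> ('w \<Rightarrow> real) set \<Rightarrow> ('w \<Rightarrow> real) \<Rightarrow> ('w \<Rightarrow> real) \<Rightarrow> bool" where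
  "is_orth_projection M S Y Z \<longleftrightarrow>
     square_integrable M Z \<and>
     (\<exists>s\<in>S. AE \<omega> in M. Z \<omega> = s \<omega>) \<and>
     (\<forall>s\<in>S. has_bochner_integral M (\<lambda>\<omega>. (Y \<omega> - Z \<omega>) * s \<omega>) 0)"

end

theory Submission
  imports Defs "Jordan_Normal_Form.Determinant"
begin

text \<open>
  The projection onto a finite-dimensional subspace of \<open>L\<^sup>2\<close> is the Fourier sum over any of its
  orthonormal bases (locale \<open>orthonormal_family\<close>), so everything comes down to showing that the
  functions \<open>\<Psi>\<close>, together with the constant 1, form an orthonormal basis of the tensor-product
  spline space up to null sets.

  In one variable this rests on the Gram matrix of \<open>1, B\<^sub>2, \<dots>, B\<^sub>n\<close> being positive definite, because
  only then does its Cholesky factor exist and whiten the functions. A combination of these functions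
  with vanishing second moment vanishes on a set that accumulates from the right at every point of
  \<open>[a, b)\<close>, since the density is positive on a dense open subset. On \<open>[a, b)\<close> the B-splines sum to 1
  (\<open>bspline_sum_eq_1\<close>), so it is also a combination of \<open>B\<^sub>1, \<dots>, B\<^sub>n\<close>, and these are independent in
  this strong sense (\<open>bspline_lin_indep\<close>). The reason is that the B-splines that start at a given
  knot vanish there from the right to pairwise different orders
  (\<open>bspline_order_at_left_knot\<close>). The same partition of unity shows that \<open>\<psi>\<^sub>1, \<dots>, \<psi>\<^sub>n\<close> span the
  spline space on \<open>[a, b)\<close>, an event of probability one. Moreover \<open>\<psi>\<^sub>1 = 1\<close>, because the Cholesky
  factor is triangular and its first entry is \<open>1\<close>.

  In several variables, independence factorizes expectations, so the products
  \<open>\<psi>\<^sub>i\<^sub>1(X\<^sub>1) \<cdots> \<psi>\<^sub>i\<^sub>N(X\<^sub>N)\<close> over all multi-indices are orthonormal, and multiplying out shows that they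
  span the tensor-product space. Since \<open>\<psi>\<^sub>1 = 1\<close>, such a product only depends on the variables in
  the set \<open>u\<close> of positions with index at least 2; sorting the multi-indices
      by \<open>u\<close> turns the Fourier sum into
  the stated decomposition (\<open>sum_full_index_set\<close>). The integral formulas hold because the joint law
  of independent variables has the product density (\<open>distributed_joint_density\<close>).
\<close>

section \<open>Linear independence of B-splines\<close>

lemma bspline_eq_0_outside_support:
  assumes "mono_on {i..i + p + 1} \<xi>" "x < \<xi> i \<or> \<xi> (i + p + 1) \<le> x"
  shows "bspline i p \<xi> x = 0"
  using assms
proof (induction p arbitrary: i)
  case (Suc p)
  have "mono_on {i..i + p + 1} \<xi>" "mono_on {i + 1..(i + 1) + p + 1} \<xi>"
    by (rule mono_on_subset[OF Suc.prems(1)]; auto)+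
  moreover have "\<xi> i \<le> \<xi> (i + 1)" "\<xi> (i + p + 1) \<le> \<xi> (i + Suc p + 1)"
    by (intro mono_onD[OF Suc.prems(1)]; simp)+
  ultimately have "bspline i p \<xi> x = 0" "bspline (i + 1) p \<xi> x = 0"
    using Suc.prems(2) Suc.IH[of i] Suc.IH[of "i + 1"] by auto
  then show ?case by simp
qed auto

text \<open>
  The half-open convention for degree 0 makes a B-spline vanish identically when all its knots
  coincide. This justifies \<open>0/0 = 0\<close> in the recursion: a weight with denominator 0 always multiplies
  such a B-spline.
\<close>

lemma bspline_eq_0_degenerate:
  assumes "mono_on {i..i + p + 1} \<xi>" "\<xi> (i + p + 1) = \<xi> i"
  shows "bspline i p \<xi> x = 0"
  using assms by (intro bspline_eq_0_outside_support) auto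

lemma bspline_partition_of_unity:
  assumes "mono_on {l..h + p + 1} \<xi>" "\<xi> (l + p) \<le> x" "x < \<xi> (h + 1)" "l \<le> h + 1"
  shows "(\<Sum>i = l..h. bspline i p \<xi> x) = 1"
  using assms
proof (induction p arbitrary: l)
  case 0
  have "(\<Sum>i = l..h. bspline i 0 \<xi> x)
      = (\<Sum>i = l..h. of_bool (x < \<xi> (Suc i)) - of_bool (x < \<xi> i))"
  proof (rule sum.cong[OF refl])
    fix i assume "i \<in> {l..h}"
    then have "\<xi> i \<le> \<xi> (Suc i)" by (intro mono_onD[OF 0(1)]) auto
    then show "bspline i 0 \<xi> x = of_bool (x < \<xi> (Suc i)) - of_bool (x < \<xi> i)" by auto
  qed
  also have "\<dots> = of_bool (x < \<xi> (Suc h)) - of_bool (x < \<xi> l)"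
    using 0(4) by (subst sum_Suc_diff) auto
  finally show ?case using 0 by simp
next
  case (Suc p)
  define w where "w i = (x - \<xi> i) / (\<xi> (i + Suc p) - \<xi> i)" for i
  define v where "v i = w i * bspline i p \<xi> x" for i
  have lh: "l + Suc p \<le> h"
  proof (rule ccontr)
    assume "\<not> l + Suc p \<le> h"
    then have "\<xi> (h + 1) \<le> \<xi> (l + Suc p)"
      using Suc.prems(4) by (intro mono_onD[OF Suc.prems(1)]) auto
    with Suc.prems show False by simp
  qed
  have m: "mono_on {i..i + p + 1} \<xi>" if "i \<in> {l..h + 1}" for i
    by (rule mono_on_subset[OF Suc.prems(1)]) (use that in auto)
  \<comment> \<open>The two weights that the recursion gives to one B-spline of lower degree add up to 1, so
    the sum telescopes.\<close>
  have step: "bspline i (Suc p) \<xi> x = bspline (i + 1) p \<xi> x + (v i - v (i + 1))"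
    if "i \<in> {l..h}" for i
  proof (cases "\<xi> (i + 1 + p + 1) = \<xi> (i + 1)")
    case True
    with m[of "i + 1"] that have "bspline (i + 1) p \<xi> x = 0"
      by (intro bspline_eq_0_degenerate) auto
    then show ?thesis by (simp add: v_def w_def)
  next
    case False
    then have "(\<xi> (i + Suc p + 1) - x) / (\<xi> (i + Suc p + 1) - \<xi> (i + 1)) = 1 - w (i + 1)"
      by (simp add: w_def field_simps)
    note weight = this
    then show ?thesis
      unfolding bspline.simps weight by (simp add: v_def w_def[of i] algebra_simps)
  qed
  have "(\<Sum>i = l..h. bspline i (Suc p) \<xi> x) = (\<Sum>i = l..h. bspline (Suc i) p \<xi> x) + (\<Sum>i
      = l..h. v i - v (Suc i))"
    using step by (simp add: sum.distrib)
  also have "(\<Sum>i = l..h. v i - v (Suc i)) = v l - v (Suc h)"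
    using lh sum_Suc_diff[of l h "\<lambda>i. - v i"] by (simp add: sum_subtractf)
  also have "v l = 0"
    using bspline_eq_0_outside_support[OF m[of l]] Suc.prems by (simp add: v_def)
  also have "v (Suc h) = 0"
    using bspline_eq_0_outside_support[OF m[of "Suc h"], of x] Suc.prems by (simp add: v_def)
  also have "(\<Sum>i = l..h. bspline (Suc i) p \<xi> x) = (\<Sum>i = Suc l..Suc h. bspline i p \<xi> x)"
    by (rule sum.shift_bounds_cl_Suc_ivl[symmetric])
  also have "\<dots> = (\<Sum>i = Suc l..h. bspline i p \<xi> x)"
    using bspline_eq_0_outside_support[OF m[of "Suc h"], of x] Suc.prems lh by simp
  also have "\<dots> = 1"
    using Suc.prems lh by (intro Suc.IH mono_on_subset[OF Suc.prems(1)]) auto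
  finally show ?case by simp
qed

text \<open>
  If the leftmost knot \<open>z\<close> of a B-spline is repeated \<open>m + 1\<close> times, the B-spline behaves like
  \<open>C (t - z)\<^sup>p\<^sup>-\<^sup>m\<close> to the right of \<open>z\<close>. Each term of the recursion has this order or is zero near
  \<open>z\<close>: the weight of the first one contributes a factor \<open>t - z\<close>, and the second one loses one
  repetition of \<open>z\<close> together with one degree. As the leading coefficients are nonnegative and not
  both zero, nothing cancels.
\<close>

lemma bspline_order_at_left_knot:
  assumes "mono_on {i..i + p + 1} \<xi>" "m \<le> p" "\<xi> i = z" "\<xi> (i + m) = z" "z < \<xi> (i + m + 1)"
  shows "\<exists>C>0. ((\<lambda>t. bspline i p \<xi> t / (t - z) ^ (p - m)) \<longlongrightarrow> C) (at_right z)"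
  using assms
proof (induction p arbitrary: i m)
  case 0
  have "\<forall>\<^sub>F t in at_right z. bspline i 0 \<xi> t / (t - z) ^ (0 - m) = 1"
    unfolding eventually_at_right_field using 0 by (intro exI[of _ "\<xi> (i + 1)"]) auto
  then show ?case by (intro exI[of _ 1] conjI tendsto_eventually) auto
next
  case (Suc p)
  have mono1: "mono_on {i..i + p + 1} \<xi>" and mono2: "mono_on {i + 1..(i + 1) + p + 1} \<xi>"
    by (rule mono_on_subset[OF Suc.prems(1)]; auto)+
  have gt: "z < \<xi> (i + Suc p + 1)"
  proof -
    have "\<xi> (i + m + 1) \<le> \<xi> (i + Suc p + 1)"
      using Suc.prems by (intro mono_onD[OF Suc.prems(1)]) auto
    with Suc.prems show ?thesis by simp
  qed
  define A where "A t = (t - \<xi> i) / (\<xi> (i + Suc p) - \<xi> i) * bspline i p \<xi> t" for t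
  define B where "B t = (\<xi> (i + Suc p + 1) - t) / (\<xi> (i + Suc p + 1) - \<xi> (i + 1))
    * bspline (i + 1) p \<xi> t" for t
  have A: "\<exists>C. (C > 0 \<or> C = 0 \<and> m = Suc p) \<and> ((\<lambda>t. A t / (t - z) ^ (Suc p - m)) \<longlongrightarrow> C) (at_right z)"
  proof (cases "m = Suc p")
    case True
    then have "A t = 0" for t using Suc.prems by (simp add: A_def)
    then show ?thesis using True by auto
  next
    case False
    then have m: "m \<le> p" using Suc.prems by simp
    from Suc.IH[OF mono1 m Suc.prems(3,4,5)] obtain C where C: "C > 0"
      "((\<lambda>t. bspline i p \<xi> t / (t - z) ^ (p - m)) \<longlongrightarrow> C) (at_right z)" by auto
    have "\<xi> (i + m + 1) \<le> \<xi> (i + Suc p)"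
      using m by (intro mono_onD[OF Suc.prems(1)]) auto
    then have g: "z < \<xi> (i + Suc p)" using Suc.prems by simp
    have "((\<lambda>t. bspline i p \<xi> t / (t - z) ^ (p - m) * (1 / (\<xi> (i + Suc p) - z)))
        \<longlongrightarrow> C * (1 / (\<xi> (i + Suc p) - z))) (at_right z)"
      by (intro tendsto_mult C tendsto_const)
    moreover have "\<forall>\<^sub>F t in at_right z. bspline i p \<xi> t / (t - z) ^ (p - m) * (1 / (\<xi> (i + Suc p) - z)) = A t / (t - z) ^ (Suc p - m)"
      using eventually_at_right_less[of z]
      by eventually_elim (use m g Suc.prems in \<open>simp add: A_def Suc_diff_le\<close>)
    ultimately have "((\<lambda>t. A t / (t - z) ^ (Suc p - m)) \<longlongrightarrow> C * (1 / (\<xi> (i + Suc p) - z))) (at_right z)"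
      by (rule Lim_transform_eventually)
    then show ?thesis using C g by (intro exI[of _ "C * (1 / (\<xi> (i + Suc p) - z))"]) auto
  qed
  have B: "\<exists>C. (C > 0 \<or> C = 0 \<and> m = 0) \<and> ((\<lambda>t. B t / (t - z) ^ (Suc p - m)) \<longlongrightarrow> C) (at_right z)"
  proof (cases m)
    case 0
    \<comment> \<open>The second B-spline starts strictly to the right of \<open>z\<close>.\<close>
    have "\<forall>\<^sub>F t in at_right z. B t / (t - z) ^ (Suc p - m) = 0"
      unfolding eventually_at_right_field using 0 Suc.prems bspline_eq_0_outside_support[OF mono2]
      by (intro exI[of _ "\<xi> (i + 1)"]) (auto simp: B_def)
    then have "((\<lambda>t. B t / (t - z) ^ (Suc p - m)) \<longlongrightarrow> 0) (at_right z)" by (rule tendsto_eventually)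
    then show ?thesis using 0 by blast
  next
    case (Suc m')
    have le: "z \<le> \<xi> (i + 1)" "\<xi> (i + 1) \<le> \<xi> (i + m)"
      unfolding Suc.prems(3)[symmetric] using Suc Suc.prems(2)
      by (auto intro!: mono_onD[OF Suc.prems(1)])
    then have z: "\<xi> (i + 1) = z" using Suc.prems by simp
    from Suc.IH[OF mono2, of m'] Suc Suc.prems z obtain C where C: "C > 0"
      "((\<lambda>t. bspline (i + 1) p \<xi> t / (t - z) ^ (p - m')) \<longlongrightarrow> C) (at_right z)" by auto
    have "((\<lambda>t. (\<xi> (i + Suc p + 1) - t) / (\<xi> (i + Suc p + 1) - z) * (bspline (i + 1) p \<xi> t / (t - z) ^ (p - m')))
        \<longlongrightarrow> (\<xi> (i + Suc p + 1) - z) / (\<xi> (i + Suc p + 1) - z) * C) (at_right z)"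
      by (intro tendsto_intros C) (use gt in auto)
    then have "((\<lambda>t. B t / (t - z) ^ (Suc p - m)) \<longlongrightarrow> C) (at_right z)"
      using gt by (simp add: B_def z[simplified] Suc)
    then show ?thesis using C(1) by blast
  qed
  from A B obtain C C' where C: "C > 0 \<or> C = 0 \<and> m = Suc p" "C' > 0 \<or> C' = 0 \<and> m = 0"
    "((\<lambda>t. A t / (t - z) ^ (Suc p - m)) \<longlongrightarrow> C) (at_right z)"
    "((\<lambda>t. B t / (t - z) ^ (Suc p - m)) \<longlongrightarrow> C') (at_right z)" by blast
  have "((\<lambda>t. bspline i (Suc p) \<xi> t / (t - z) ^ (Suc p - m)) \<longlongrightarrow> C + C') (at_right z)"
    using tendsto_add[OF C(3,4)] by (simp add: A_def B_def add_divide_distrib)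
  moreover have "C + C' > 0" using C(1,2) by auto
  ultimately show ?case by blast
qed

lemma
  assumes "open_knot_sequence p n a b \<xi>"
  shows open_knot_sequence_mono: "mono_on {1..n + p + 1} \<xi>"
    and open_knot_sequence_left: "\<xi> (p + 1) = a"
    and open_knot_sequence_right: "\<xi> (n + 1) = b"
    and open_knot_sequence_ge: "i \<in> {1..n} \<Longrightarrow> a \<le> \<xi> i"
    and open_knot_sequence_less: "i \<in> {1..n} \<Longrightarrow> \<xi> i < b"
    and open_knot_sequence_support: "i \<in> {1..n} \<Longrightarrow> \<xi> i < \<xi> (i + p + 1)"
proof -
  from assms obtain r :: nat and \<zeta> :: "nat \<Rightarrow> real" where mono: "mono_on {1..n + p + 1} \<xi>"
      and r: "1 \<le> r" "strict_mono_on {1..r} \<zeta>"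
    "\<zeta> 1 = a" "\<zeta> r = b" and im: "\<xi> ` {1..n + p + 1} = \<zeta> ` {1..r}"
    and mult: "knot_mult p n \<xi> (\<zeta> 1) = p + 1" "knot_mult p n \<xi> (\<zeta> r) = p + 1"
      "\<forall>j. 1 < j \<and> j < r \<longrightarrow> 1 \<le> knot_mult p n \<xi> (\<zeta> j) \<and> knot_mult p n \<xi> (\<zeta> j) \<le> p + 1"
    and pn: "p < n"
    unfolding open_knot_sequence_def by blast
  show "mono_on {1..n + p + 1} \<xi>" by fact
  have fin: "finite {i \<in> {1..n + p + 1}. \<xi> i = z}" for z by simp
  have range: "a \<le> \<xi> i \<and> \<xi> i \<le> b \<and> knot_mult p n \<xi> (\<xi> i) \<le> p + 1" if i: "i \<in> {1..n + p + 1}" for i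
  proof -
    obtain j where j: "j \<in> {1..r}" "\<xi> i = \<zeta> j" using im i by blast
    have m: "mono_on {1..r} \<zeta>" by (rule strict_mono_on_imp_mono_on) fact
    have "\<zeta> 1 \<le> \<zeta> j" "\<zeta> j \<le> \<zeta> r" using j by (auto intro!: mono_onD[OF m])
    moreover have "knot_mult p n \<xi> (\<zeta> j) \<le> p + 1"
      using j mult by (cases "j = 1"; cases "j = r") auto
    ultimately show ?thesis using j r by simp
  qed
  show left: "\<xi> (p + 1) = a"
  proof (rule ccontr)
    assume "\<xi> (p + 1) \<noteq> a"
    then have g: "a < \<xi> (p + 1)" using range[of "p + 1"] pn by simp
    have "{i \<in> {1..n + p + 1}. \<xi> i = a} \<subseteq> {1..p}"
    proof safe
      fix i assume i: "i \<in> {1..n + p + 1}" "a = \<xi> i"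
      have "i < p + 1"
      proof (rule ccontr)
        assume "\<not> i < p + 1"
        then have "\<xi> (p + 1) \<le> \<xi> i" using i by (intro mono_onD[OF mono]) auto
        with g i show False by simp
      qed
      with i show "i \<in> {1..p}" by auto
    qed
    from card_mono[OF _ this] mult(1) r show False by (simp add: knot_mult_def)
  qed
  show right: "\<xi> (n + 1) = b"
  proof (rule ccontr)
    assume "\<xi> (n + 1) \<noteq> b"
    then have g: "\<xi> (n + 1) < b" using range[of "n + 1"] pn by simp
    have "{i \<in> {1..n + p + 1}. \<xi> i = b} \<subseteq> {n + 2..n + p + 1}"
    proof safe
      fix i assume i: "i \<in> {1..n + p + 1}" "b = \<xi> i"
      have "n + 1 < i"
      proof (rule ccontr)
        assume "\<not> n + 1 < i"
        then have "\<xi> i \<le> \<xi> (n + 1)" using i by (intro mono_onD[OF mono]) auto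
        with g i show False by simp
      qed
      with i show "i \<in> {n + 2..n + p + 1}" by auto
    qed
    from card_mono[OF _ this] mult(2) r show False by (simp add: knot_mult_def)
  qed
  \<comment> \<open>A run of \<open>p + 2\<close> equal knots would exceed the admissible multiplicity.\<close>
  have run: "\<xi> i < \<xi> (i + p + 1)" if i: "i \<in> {1..n}" for i
  proof (rule ccontr)
    assume neg: "\<not> \<xi> i < \<xi> (i + p + 1)"
    have "{i..i + p + 1} \<subseteq> {j \<in> {1..n + p + 1}. \<xi> j = \<xi> i}"
    proof
      fix j assume j: "j \<in> {i..i + p + 1}"
      have "\<xi> i \<le> \<xi> j" "\<xi> j \<le> \<xi> (i + p + 1)" using i j by (auto intro!: mono_onD[OF mono])
      then show "j \<in> {j \<in> {1..n + p + 1}. \<xi> j = \<xi> i}" using neg i j by auto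
    qed
    from card_mono[OF fin this] range[of i] i show False by (simp add: knot_mult_def)
  qed
  then show "i \<in> {1..n} \<Longrightarrow> \<xi> i < \<xi> (i + p + 1)" .
  show "i \<in> {1..n} \<Longrightarrow> a \<le> \<xi> i" using range[of i] by auto
  show "i \<in> {1..n} \<Longrightarrow> \<xi> i < b" using run[of i] range[of "i + p + 1"] by auto
qed

lemma bspline_sum_eq_1:
  assumes "open_knot_sequence p n a b \<xi>" "a \<le> x" "x < b"
  shows "(\<Sum>i = 1..n. bspline i p \<xi> x) = 1"
  using open_knot_sequence_mono[OF assms(1)] open_knot_sequence_left[OF assms(1)]
    open_knot_sequence_right[OF assms(1)] assms(2,3)
  by (intro bspline_partition_of_unity) (auto simp: add.commute)

text \<open>
  Let \<open>l\<close> be the first index with a nonzero coefficient and \<open>z\<close> the knot where \<open>B\<^sub>l\<close> starts. Of the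
  remaining B-splines, those that also start at \<open>z\<close> vanish to higher order there, and those that
  start later are zero near \<open>z\<close>. So \<open>d\<^sub>l B\<^sub>l\<close> dominates the sum to the right of \<open>z\<close>, which therefore
  has no zeros close to \<open>z\<close>. Asking only for zeros accumulating at each point allows the lemma to be
  applied to sums that vanish almost everywhere.
\<close>

lemma bspline_lin_indep:
  assumes knots: "open_knot_sequence p n a b \<xi>"
    and zero: "\<And>z. a \<le> z \<Longrightarrow> z < b \<Longrightarrow>
      \<exists>\<^sub>F t in at_right z. (\<Sum>i = 1..n. d i * bspline i p \<xi> t) = 0"
    and i: "i \<in> {1..n}"
  shows "d i = 0"
proof (rule ccontr)
  assume "d i \<noteq> 0"
  define P where "P j \<longleftrightarrow> j \<in> {1..n} \<and> d j \<noteq> 0" for j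
  define l where "l = (LEAST j. P j)"
  have "P i" using i \<open>d i \<noteq> 0\<close> by (simp add: P_def)
  then have l: "l \<in> {1..n}" "d l \<noteq> 0" using LeastI[of P i] by (auto simp: l_def P_def)
  have l_least: "d j = 0" if "j \<in> {1..n}" "j < l" for j
    using not_less_Least[of j P] that by (auto simp: l_def P_def)
  note mono = open_knot_sequence_mono[OF knots]
  have sub: "mono_on {j..j + p + 1} \<xi>" if "j \<in> {1..n}" for j
    by (rule mono_on_subset[OF mono]) (use that in auto)
  define z where "z = \<xi> l"
  define m' where "m' = (LEAST k. z < \<xi> (l + k))"
  have ex: "z < \<xi> (l + (p + 1))" using open_knot_sequence_support[OF knots l(1)]
      by (simp add: z_def add.assoc)
  have m': "z < \<xi> (l + m')" "m' \<le> p + 1"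
    using LeastI[of "\<lambda>k. z < \<xi> (l + k)", OF ex] Least_le[of "\<lambda>k. z < \<xi> (l + k)", OF ex]
        by (auto simp: m'_def)
  have "m' \<noteq> 0" using m'(1) by (intro notI) (simp add: z_def)
  then obtain m where m: "m' = Suc m" by (cases m') auto
  have eq: "\<xi> (l + k) = z" if "k \<le> m" for k
  proof -
    have "\<xi> l \<le> \<xi> (l + k)" using l that m' m by (intro mono_onD[OF mono]) auto
    moreover have "\<not> z < \<xi> (l + k)" using not_less_Least[of k "\<lambda>k. z < \<xi> (l + k)"] that m
        by (simp add: m'_def)
    ultimately show ?thesis by (simp add: z_def)
  qed
  have gt: "z < \<xi> (l + m + 1)" using m' m by simp
  obtain C where C: "C > 0" "((\<lambda>t. bspline l p \<xi> t / (t - z) ^ (p - m)) \<longlongrightarrow> C) (at_right z)"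
    using bspline_order_at_left_knot[OF sub[OF l(1)], of m z] eq[of m] gt m m' z_def by auto
  have lim: "((\<lambda>t. d j * (bspline j p \<xi> t / (t - z) ^ (p - m)))
      \<longlongrightarrow> (if j = l then d l * C else 0)) (at_right z)"
    if j: "j \<in> {1..n}" for j
  proof -
    consider "j < l" | "j = l" | "l < j" "j \<le> l + m" | "l + m < j" by linarith
    then show ?thesis
    proof cases
      case 1
      then show ?thesis using l_least[OF j] by simp
    next
      case 2
      then show ?thesis using tendsto_mult[OF tendsto_const C(2), of "d l"] by simp
    next
      case 3
      define k where "k = j - l"
      have k: "j = l + k" "0 < k" "k \<le> m" using 3 by (auto simp: k_def)
      have "\<exists>C>0. ((\<lambda>t. bspline j p \<xi> t / (t - z) ^ (p - (m - k))) \<longlongrightarrow> C) (at_right z)"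
        using k eq[of k] eq[of m] gt m m' by (intro bspline_order_at_left_knot sub j) auto
      then obtain C' where C': "((\<lambda>t. bspline j p \<xi> t / (t - z) ^ (p - (m - k))) \<longlongrightarrow> C') (at_right z)"
        by blast
      have "((\<lambda>t. d j * ((t - z) ^ k * (bspline j p \<xi> t / (t - z) ^ (p - (m - k)))))
          \<longlongrightarrow> d j * ((z - z) ^ k * C')) (at_right z)"
        by (intro tendsto_intros C')
      moreover have "\<forall>\<^sub>F t in at_right z. d j * ((t - z) ^ k * (bspline j p \<xi> t / (t - z) ^ (p - (m - k))))
          = d j * (bspline j p \<xi> t / (t - z) ^ (p - m))"
        using eventually_at_right_less[of z]
      proof eventually_elim
        case (elim t)
        have "p - (m - k) = k + (p - m)" using k m m' by simp
        then show ?case using elim by (simp add: power_add)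
      qed
      ultimately have "((\<lambda>t. d j * (bspline j p \<xi> t / (t - z) ^ (p - m)))
          \<longlongrightarrow> d j * ((z - z) ^ k * C')) (at_right z)"
        by (rule Lim_transform_eventually)
      then show ?thesis using k by (simp add: power_0_left)
    next
      case 4
      have "\<xi> (l + m + 1) \<le> \<xi> j" using 4 l j by (intro mono_onD[OF mono]) auto
      then have "z < \<xi> j" using gt by simp
      then have "\<forall>\<^sub>F t in at_right z. d j * (bspline j p \<xi> t / (t - z) ^ (p - m)) = 0"
        unfolding eventually_at_right_field using bspline_eq_0_outside_support[OF sub[OF j]]
        by (intro exI[of _ "\<xi> j"]) auto
      then show ?thesis using 4 by (auto intro: tendsto_eventually)
    qed
  qed
  have "((\<lambda>t. \<Sum>j = 1..n. d j * (bspline j p \<xi> t / (t - z) ^ (p - m)))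
      \<longlongrightarrow> (\<Sum>j = 1..n. if j = l then d l * C else 0)) (at_right z)"
    by (intro tendsto_sum lim)
  then have "((\<lambda>t. (\<Sum>j = 1..n. d j * bspline j p \<xi> t) / (t - z) ^ (p - m)) \<longlongrightarrow> d l * C) (at_right z)"
    using l by (simp add: sum_divide_distrib)
  then have "\<forall>\<^sub>F t in at_right z. (\<Sum>j = 1..n. d j * bspline j p \<xi> t) / (t - z) ^ (p - m) \<noteq> 0"
    by (rule tendsto_imp_eventually_ne) (use l C(1) in auto)
  then have "\<forall>\<^sub>F t in at_right z. (\<Sum>j = 1..n. d j * bspline j p \<xi> t) \<noteq> 0"
    by (rule eventually_mono) auto
  moreover have "\<exists>\<^sub>F t in at_right z. (\<Sum>i = 1..n. d i * bspline i p \<xi> t) = 0"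
    using open_knot_sequence_ge[OF knots l(1)] open_knot_sequence_less[OF knots l(1)]
    by (intro zero) (auto simp: z_def)
  ultimately show False by (simp add: frequently_def)
qed

section \<open>Cholesky factorization\<close>

lemma forward_substitution:
  fixes q :: "nat \<Rightarrow> nat \<Rightarrow> real"
  assumes "\<And>i. i < n \<Longrightarrow> q i i \<noteq> 0"
  shows "\<exists>w. \<forall>j<n. (\<Sum>k\<le>j. q j k * w k) = g j"
  using assms
proof (induction n)
  case (Suc n)
  then obtain w where w: "\<forall>j<n. (\<Sum>k\<le>j. q j k * w k) = g j" by auto
  define w' where "w' = w(n := (g n - (\<Sum>k<n. q n k * w k)) / q n n)"
  have "(\<Sum>k\<le>j. q j k * w' k) = g j" if "j < Suc n" for j
  proof (cases "j = n")
    case True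
    have "(\<Sum>k<n. q n k * w' k) = (\<Sum>k<n. q n k * w k)"
      by (intro sum.cong) (auto simp: w'_def)
    then show ?thesis
      using Suc.prems[of n] True by (simp add: lessThan_Suc_atMost[symmetric] w'_def)
  next
    case False
    then have "(\<Sum>k\<le>j. q j k * w' k) = (\<Sum>k\<le>j. q j k * w k)"
      using that by (intro sum.cong) (auto simp: w'_def)
    then show ?thesis using w that False by auto
  qed
  then show ?case by blast
qed simp

text \<open>
  Solves \<open>q\<^sup>T c = w\<close>. The last equation involves the last unknown alone, hence the induction on the
  dimension with varying right-hand side.
\<close>

lemma back_substitution:
  fixes q :: "nat \<Rightarrow> nat \<Rightarrow> real"
  assumes "\<And>i. i < n \<Longrightarrow> q i i \<noteq> 0"
    and "\<And>i k. i < k \<Longrightarrow> k < n \<Longrightarrow> q i k = 0"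
  shows "\<exists>c. \<forall>k<n. (\<Sum>i<n. q i k * c i) = w k"
  using assms
proof (induction n arbitrary: w)
  case (Suc n)
  define cn where "cn = w n / q n n"
  obtain c where c: "\<forall>k<n. (\<Sum>i<n. q i k * c i) = w k - q n k * cn"
    using Suc.IH[of "\<lambda>k. w k - q n k * cn"] Suc.prems by auto
  define c' where "c' = c(n := cn)"
  have eq: "(\<Sum>i<n. q i k * c' i) = (\<Sum>i<n. q i k * c i)" for k
    by (intro sum.cong) (auto simp: c'_def)
  have "(\<Sum>i<Suc n. q i k * c' i) = w k" if "k < Suc n" for k
  proof (cases "k = n")
    case True
    have "(\<Sum>i<n. q i n * c' i) = 0"
      using Suc.prems(2) by (intro sum.neutral) auto
    then show ?thesis using Suc.prems(1)[of n] True by (simp add: c'_def cn_def)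
  next
    case False
    then show ?thesis using c that by (simp add: eq) (simp add: c'_def)
  qed
  then show ?case by blast
qed simp

text \<open>
  The factor is built row by row: the entries left of the diagonal solve a triangular system, and
  the remaining Schur complement is the value of the quadratic form at a nonzero vector.
\<close>

lemma cholesky_factor_exists:
  fixes G :: "nat \<Rightarrow> nat \<Rightarrow> real"
  assumes sym: "\<And>i j. i < n \<Longrightarrow> j < n \<Longrightarrow> G i j = G j i"
    and pd: "\<And>c. \<exists>i<n. c i \<noteq> 0 \<Longrightarrow> (\<Sum>i<n. \<Sum>j<n. c i * c j * G i j) > 0"
  shows "\<exists>q. (\<forall>i<n. q i i > 0) \<and> (\<forall>i j. i < j \<longrightarrow> j < n \<longrightarrow> q i j = 0) \<and>
    (\<forall>i<n. \<forall>j<n. G i j = (\<Sum>k<n. q i k * q j k))"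
  using assms
proof (induction n)
  case (Suc n)
  have pd': "(\<Sum>i<n. \<Sum>j<n. c i * c j * G i j) > 0" if "\<exists>i<n. c i \<noteq> 0" for c
  proof -
    define c' where "c' = c(n := 0)"
    have "(\<Sum>i<Suc n. \<Sum>j<Suc n. c' i * c' j * G i j) > 0"
      using that by (intro Suc.prems(2)) (auto simp: c'_def intro: less_SucI)
    also have "(\<Sum>i<Suc n. \<Sum>j<Suc n. c' i * c' j * G i j) = (\<Sum>i<n. \<Sum>j<n. c' i * c' j * G i j)"
      by (simp add: c'_def)
    also have "\<dots> = (\<Sum>i<n. \<Sum>j<n. c i * c j * G i j)"
      by (intro sum.cong refl) (auto simp: c'_def)
    finally show ?thesis .
  qed
  obtain q where q: "\<forall>i<n. q i i > 0" "\<forall>i j. i < j \<longrightarrow> j < n \<longrightarrow> q i j = 0"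
      "\<forall>i<n. \<forall>j<n. G i j = (\<Sum>k<n. q i k * q j k)"
    using Suc.IH[OF Suc.prems(1) pd'] by auto
  have nz: "q i i \<noteq> 0" if "i < n" for i using q(1) that by force
  obtain w where "\<forall>j<n. (\<Sum>k\<le>j. q j k * w k) = G n j"
    using forward_substitution[of n q "G n"] nz by auto
  moreover have "(\<Sum>k<n. q j k * w k) = (\<Sum>k\<le>j. q j k * w k)" if "j < n" for j
    using that q(2) by (intro sum.mono_neutral_right) auto
  ultimately have w: "(\<Sum>k<n. q j k * w k) = G n j" if "j < n" for j using that by simp
  obtain c where c: "\<forall>k<n. (\<Sum>i<n. q i k * c i) = w k"
    using back_substitution[of n q w] nz q(2) by auto
  \<comment> \<open>The square of the new diagonal entry. With \<open>c = q\<^sup>-\<^sup>T w\<close>, it is the value of the quadratic form at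
    \<open>(-c, 1)\<close>.\<close>
  define S where "S = G n n - (\<Sum>k<n. (w k)\<^sup>2)"
  have S: "S > 0"
  proof -
    define c' where "c' = (\<lambda>i. if i < n then - c i else 1)"
    have lin: "(\<Sum>i<n. c i * G n i) = (\<Sum>k<n. (w k)\<^sup>2)"
    proof -
      have "(\<Sum>i<n. c i * G n i) = (\<Sum>i<n. \<Sum>k<n. c i * (q i k * w k))"
        by (intro sum.cong) (auto simp: w[symmetric] sum_distrib_left)
      also have "\<dots> = (\<Sum>k<n. \<Sum>i<n. c i * (q i k * w k))" by (rule sum.swap)
      also have "\<dots> = (\<Sum>k<n. w k * (\<Sum>i<n. q i k * c i))"
        by (simp add: sum_distrib_left algebra_simps)
      also have "\<dots> = (\<Sum>k<n. (w k)\<^sup>2)" using c by (simp add: power2_eq_square)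
      finally show ?thesis .
    qed
    have quad: "(\<Sum>i<n. \<Sum>j<n. c i * c j * G i j) = (\<Sum>k<n. (w k)\<^sup>2)"
    proof -
      have "(\<Sum>j<n. c i * c j * G i j) = c i * G n i" if i: "i < n" for i
      proof -
        have "(\<Sum>j<n. c i * c j * G i j) = (\<Sum>j<n. \<Sum>k<n. c i * c j * (q i k * q j k))"
          using q(3) i by (simp add: sum_distrib_left)
        also have "\<dots> = (\<Sum>k<n. \<Sum>j<n. c i * c j * (q i k * q j k))" by (rule sum.swap)
        also have "\<dots> = c i * (\<Sum>k<n. q i k * (\<Sum>j<n. q j k * c j))"
          by (simp add: sum_distrib_left algebra_simps)
        also have "\<dots> = c i * G n i" using c w[OF i] by simp
        finally show ?thesis .
      qed
      then show ?thesis by (simp add: lin)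
    qed
    have "0 < (\<Sum>i<Suc n. \<Sum>j<Suc n. c' i * c' j * G i j)"
      by (intro Suc.prems(2)) (auto simp: c'_def)
    also have "\<dots> = (\<Sum>i<n. \<Sum>j<n. c i * c j * G i j) - (\<Sum>i<n. c i * G i n) - (\<Sum>i<n. c i * G n i) + G n n"
      by (simp add: c'_def sum.distrib sum_negf sum_subtractf)
    also have "(\<Sum>i<n. c i * G i n) = (\<Sum>i<n. c i * G n i)"
      using Suc.prems(1) by (intro sum.cong) auto
    finally show ?thesis by (simp add: lin quad S_def)
  qed
  define q' where "q' i k = (if k < n then (if i < n then q i k else w k)
    else if i = n \<and> k = n then sqrt S else 0)" for i k
  have "q' i i > 0" if "i < Suc n" for i using that q(1) S by (auto simp: q'_def)
  moreover have "q' i j = 0" if "i < j" "j < Suc n" for i j using that q(2) by (auto simp: q'_def)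
  moreover have "G i j = (\<Sum>k<Suc n. q' i k * q' j k)" if ij: "i < Suc n" "j < Suc n" for i j
  proof -
    consider "i < n" "j < n" | "i = n" "j < n" | "i < n" "j = n" | "i = n" "j = n"
      using ij by linarith
    then show ?thesis
    proof cases
      case 1
      then show ?thesis using q(3) by (simp add: q'_def)
    next
      case 2
      then show ?thesis using w[of j] by (simp add: q'_def mult.commute)
    next
      case 3
      then show ?thesis using w[of i] Suc.prems(1)[of i n] by (simp add: q'_def)
    next
      case 4
      then show ?thesis using S by (simp add: q'_def S_def power2_eq_square)
    qed
  qed
  ultimately show ?case by blast
qed simp

lemma is_cholesky_factorD:
  assumes "is_cholesky_factor G Q" "G \<in> carrier_mat n n"
  shows "Q \<in> carrier_mat n n" "\<And>i j. i < j \<Longrightarrow> j < n \<Longrightarrow> Q $$ (i, j) = 0"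
    "\<And>i. i < n \<Longrightarrow> 0 < Q $$ (i, i)" "G = Q * transpose_mat Q"
  using assms by (auto simp: is_cholesky_factor_def)

lemma cholesky_entry:
  assumes "is_cholesky_factor G Q" "G \<in> carrier_mat n n" "i < n" "j < n"
  shows "G $$ (i, j) = (\<Sum>k<j. Q $$ (i, k) * Q $$ (j, k)) + Q $$ (i, j) * Q $$ (j, j)"
proof -
  note Q = is_cholesky_factorD[OF assms(1,2)]
  have "G $$ (i, j) = (\<Sum>k<n. Q $$ (i, k) * Q $$ (j, k))"
    using Q(1) assms(3,4) by (subst Q(4)) (simp add: scalar_prod_def lessThan_atLeast0)
  also have "\<dots> = (\<Sum>k<Suc j. Q $$ (i, k) * Q $$ (j, k))"
    using Q(2) assms(4) by (intro sum.mono_neutral_right) auto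
  finally show ?thesis by simp
qed

text \<open>
  Column by column, the diagonal entry is determined as a positive square root, and the entries
  below it by division.
\<close>

lemma cholesky_factor_unique:
  assumes Q: "is_cholesky_factor G Q" and R: "is_cholesky_factor G R" and G: "G \<in> carrier_mat n n"
  shows "Q = R"
proof -
  note Q' = is_cholesky_factorD[OF Q G] and R' = is_cholesky_factorD[OF R G]
  have "\<forall>i<n. Q $$ (i, j) = R $$ (i, j)" if "j < n" for j
    using that
  proof (induction j rule: less_induct)
    case (less j)
    have eq: "Q $$ (i, j) * Q $$ (j, j) = R $$ (i, j) * R $$ (j, j)" if "i < n" for i
    proof -
      have "(\<Sum>k<j. Q $$ (i, k) * Q $$ (j, k)) = (\<Sum>k<j. R $$ (i, k) * R $$ (j, k))"
        using less that by (intro sum.cong) auto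
      then show ?thesis
        using cholesky_entry[OF Q G that less.prems] cholesky_entry[OF R G that less.prems] by simp
    qed
    have "(Q $$ (j, j))\<^sup>2 = (R $$ (j, j))\<^sup>2"
      using eq[OF less.prems] by (simp add: power2_eq_square)
    then have diag: "Q $$ (j, j) = R $$ (j, j)"
      using Q'(3)[OF less.prems] R'(3)[OF less.prems] by (simp add: power2_eq_iff_nonneg)
    then show ?case using eq Q'(3)[OF less.prems] by auto
  qed
  then show ?thesis using Q'(1) R'(1) by (intro eq_matI) auto
qed

lemma cholesky_is_factor:
  fixes G :: "real Matrix.mat"
  assumes G: "G \<in> carrier_mat n n"
    and sym: "\<And>i j. i < n \<Longrightarrow> j < n \<Longrightarrow> G $$ (i, j) = G $$ (j, i)"
    and pd: "\<And>c. \<exists>i<n. c i \<noteq> 0 \<Longrightarrow> (\<Sum>i<n. \<Sum>j<n. c i * c j * G $$ (i, j)) > 0"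
  shows "is_cholesky_factor G (cholesky G)"
proof -
  obtain q where q: "\<forall>i<n. q i i > 0" "\<forall>i j. i < j \<longrightarrow> j < n \<longrightarrow> q i j = 0"
      "\<forall>i<n. \<forall>j<n. G $$ (i, j) = (\<Sum>k<n. q i k * q j k)"
    using cholesky_factor_exists[of n "\<lambda>i j. G $$ (i, j)"] sym pd by auto
  have factor: "is_cholesky_factor G (Matrix.mat n n (\<lambda>(i, j). q i j))"
    unfolding is_cholesky_factor_def using G q
    by (auto intro!: eq_matI simp: scalar_prod_def lessThan_atLeast0)
  then have "\<exists>!Q. is_cholesky_factor G Q"
    by (rule ex1I) (rule cholesky_factor_unique[OF _ factor G])
  then show ?thesis unfolding cholesky_def by (rule theI')
qed

lemma cholesky_factor_inverse:
  assumes Q: "is_cholesky_factor G Q" and G: "G \<in> carrier_mat n n"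
  shows "the (mat_inverse Q) \<in> carrier_mat n n" "the (mat_inverse Q) * Q = 1\<^sub>m n"
    "Q * the (mat_inverse Q) = 1\<^sub>m n"
proof -
  note Q' = is_cholesky_factorD[OF Q G]
  have "det Q = prod_list (diag_mat Q)"
    by (rule det_lower_triangular[OF _ Q'(1)]) (rule Q'(2))
  also have "\<dots> \<noteq> 0"
    using Q'(1,3) unfolding prod_list_zero_iff diag_mat_def by force
  finally have "Q \<in> Units (ring_mat TYPE(real) n ())"
    by (rule det_non_zero_imp_unit[OF Q'(1)])
  then obtain B where "mat_inverse Q = Some B"
    using mat_inverse(1)[OF Q'(1), where b = "()"] by (cases "mat_inverse Q") auto
  with mat_inverse(2)[OF Q'(1) this]
  show "the (mat_inverse Q) \<in> carrier_mat n n" "the (mat_inverse Q) * Q = 1\<^sub>m n"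
    "Q * the (mat_inverse Q) = 1\<^sub>m n" by auto
qed

text \<open>
  In matrix terms, \<open>R G R\<^sup>T = R Q (R Q)\<^sup>T = 1\<close>. The double sum is the form in which second moments
  of linear combinations appear.
\<close>

lemma cholesky_whitening:
  assumes Q: "is_cholesky_factor G Q" and G: "G \<in> carrier_mat n n" and ij: "i < n" "j < n"
  defines "R \<equiv> the (mat_inverse Q)"
  shows "(\<Sum>k<n. \<Sum>l<n. R $$ (i, k) * R $$ (j, l) * G $$ (k, l)) = (if i = j then 1 else 0)"
proof -
  note Q' = is_cholesky_factorD[OF Q G]
  note R = cholesky_factor_inverse[OF Q G, folded R_def]
  have RQ: "(\<Sum>k<n. R $$ (a, k) * Q $$ (k, m)) = (if a = m then 1 else 0)" if "a < n" "m < n" for a m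
  proof -
    have "(R * Q) $$ (a, m) = (\<Sum>k<n. R $$ (a, k) * Q $$ (k, m))"
      using R(1) Q'(1) that by (simp add: scalar_prod_def lessThan_atLeast0)
    then show ?thesis using that by (simp add: R(2))
  qed
  have "(\<Sum>k<n. \<Sum>l<n. R $$ (i, k) * R $$ (j, l) * G $$ (k, l))
      = (\<Sum>k<n. \<Sum>l<n. \<Sum>m<n. R $$ (i, k) * R $$ (j, l) * (Q $$ (k, m) * Q $$ (l, m)))"
  proof (intro sum.cong refl)
    fix k l assume "k \<in> {..<n}" "l \<in> {..<n}"
    then have "G $$ (k, l) = (\<Sum>m<n. Q $$ (k, m) * Q $$ (l, m))"
      using Q'(1) by (subst Q'(4)) (simp add: scalar_prod_def lessThan_atLeast0)
    then show "R $$ (i, k) * R $$ (j, l) * G $$ (k, l)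
        = (\<Sum>m<n. R $$ (i, k) * R $$ (j, l) * (Q $$ (k, m) * Q $$ (l, m)))"
      by (simp add: sum_distrib_left)
  qed
  also have "\<dots> = (\<Sum>k<n. \<Sum>m<n. \<Sum>l<n. R $$ (i, k) * R $$ (j, l) * (Q $$ (k, m) * Q $$ (l, m)))"
    by (intro sum.cong refl sum.swap)
  also have "\<dots> = (\<Sum>m<n. \<Sum>k<n. \<Sum>l<n. R $$ (i, k) * R $$ (j, l) * (Q $$ (k, m) * Q $$ (l, m)))"
    by (rule sum.swap)
  also have "\<dots> = (\<Sum>m<n. (\<Sum>k<n. R $$ (i, k) * Q $$ (k, m)) * (\<Sum>l<n. R $$ (j, l) * Q $$ (l, m)))"
    by (simp add: sum_product algebra_simps)
  also have "\<dots> = (\<Sum>m<n. if m = i then (if i = j then 1 else 0) else 0)"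
    by (intro sum.cong refl) (auto simp: RQ ij)
  also have "\<dots> = (if i = j then 1 else 0)" using ij by simp
  finally show ?thesis .
qed

section \<open>Spline spaces consist of bounded Borel functions\<close>

lemma borel_measurable_bspline [measurable]: "bspline i p \<xi> \<in> borel_measurable borel"
proof (induction p arbitrary: i)
  case 0
  have "bspline i 0 \<xi> = (\<lambda>x. if \<xi> i \<le> x \<and> x < \<xi> (i + 1) then 1 else 0)" by (rule ext) simp
  then show ?case by simp
next
  case (Suc p)
  note Suc[measurable]
  have "bspline i (Suc p) \<xi> = (\<lambda>x. (x - \<xi> i) / (\<xi> (i + Suc p) - \<xi> i) * bspline i p \<xi> x
     + (\<xi> (i + Suc p + 1) - x) / (\<xi> (i + Suc p + 1) - \<xi> (i + 1)) * bspline (i + 1) p \<xi> x)"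
    by (rule ext) simp
  then show ?case by simp
qed

text \<open>
  The functions that are certain to have finite moments under every distribution on \<open>[a, b]\<close>. They
  are closed under the operations that build products of splines.
\<close>

definition bounded_borel_on :: "real \<Rightarrow> real \<Rightarrow> (real \<Rightarrow> real) \<Rightarrow> bool" where
  "bounded_borel_on a b g \<longleftrightarrow> g \<in> borel_measurable borel \<and> (\<exists>K. \<forall>x\<in>{a..b}. \<bar>g x\<bar> \<le> K)"

lemma bounded_borel_on_const: "bounded_borel_on a b (\<lambda>_. c)"
  by (auto simp: bounded_borel_on_def)

lemma bounded_borel_on_mult:
  assumes "bounded_borel_on a b g" "bounded_borel_on a b h"
  shows "bounded_borel_on a b (\<lambda>x. g x * h x)"
proof -
  from assms obtain K L where KL: "\<forall>x\<in>{a..b}. \<bar>g x\<bar> \<le> K" "\<forall>x\<in>{a..b}. \<bar>h x\<bar> \<le> L"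
    by (auto simp: bounded_borel_on_def)
  have "\<bar>g x * h x\<bar> \<le> K * L" if "x \<in> {a..b}" for x
    unfolding abs_mult using KL that by (intro mult_mono) (auto intro: order_trans[OF abs_ge_zero])
  then have "\<exists>K. \<forall>x\<in>{a..b}. \<bar>g x * h x\<bar> \<le> K" by blast
  with assms show ?thesis by (auto simp: bounded_borel_on_def)
qed

lemma bounded_borel_on_add:
  assumes "bounded_borel_on a b g" "bounded_borel_on a b h"
  shows "bounded_borel_on a b (\<lambda>x. g x + h x)"
proof -
  from assms obtain K L where KL: "\<forall>x\<in>{a..b}. \<bar>g x\<bar> \<le> K" "\<forall>x\<in>{a..b}. \<bar>h x\<bar> \<le> L"
    by (auto simp: bounded_borel_on_def)
  have "\<bar>g x + h x\<bar> \<le> K + L" if "x \<in> {a..b}" for x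
    using KL that by (intro order_trans[OF abs_triangle_ineq] add_mono) auto
  then have "\<exists>K. \<forall>x\<in>{a..b}. \<bar>g x + h x\<bar> \<le> K" by blast
  with assms show ?thesis by (auto simp: bounded_borel_on_def)
qed

lemma bounded_borel_on_sum:
  assumes "\<And>i. i \<in> I \<Longrightarrow> bounded_borel_on a b (g i)"
  shows "bounded_borel_on a b (\<lambda>x. \<Sum>i\<in>I. g i x)"
  using assms
  by (induction I rule: infinite_finite_induct)
    (simp_all add: bounded_borel_on_const bounded_borel_on_add)

lemma bounded_borel_on_bspline: "bounded_borel_on a b (bspline i p \<xi>)"
proof -
  have "\<exists>K. \<forall>x\<in>{a..b}. \<bar>bspline i p \<xi> x\<bar> \<le> K"
  proof (induction p arbitrary: i)
    case 0
    then show ?case by (intro exI[of _ 1]) auto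
  next
    case (Suc p)
    have lin: "bounded_borel_on a b (\<lambda>x. (x - c) / d)" "bounded_borel_on a b (\<lambda>x. (c - x) / d)" for c d
    proof -
      have "\<bar>(x - c) / d\<bar> \<le> (\<bar>a\<bar> + \<bar>b\<bar> + \<bar>c\<bar>) / \<bar>d\<bar> \<and> \<bar>(c - x) / d\<bar> \<le> (\<bar>a\<bar> + \<bar>b\<bar> + \<bar>c\<bar>) / \<bar>d\<bar>"
        if "x \<in> {a..b}" for x
        using that by (auto simp: abs_divide intro!: divide_right_mono)
      then show "bounded_borel_on a b (\<lambda>x. (x - c) / d)" "bounded_borel_on a b (\<lambda>x. (c - x) / d)"
        unfolding bounded_borel_on_def by (auto intro!: exI[of _ "(\<bar>a\<bar> + \<bar>b\<bar> + \<bar>c\<bar>) / \<bar>d\<bar>"])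
    qed
    have "bounded_borel_on a b (bspline i p \<xi>)" for i using Suc by (auto simp: bounded_borel_on_def)
    from bounded_borel_on_add[OF bounded_borel_on_mult[OF lin(1) this]
        bounded_borel_on_mult[OF lin(2) this]]
    show ?case unfolding bspline.simps bounded_borel_on_def by blast
  qed
  then show ?thesis by (simp add: bounded_borel_on_def)
qed

lemma sum_fun_eq: "(\<lambda>x. \<Sum>i\<in>A. g i x) = (\<Sum>i\<in>A. (g i :: 'a \<Rightarrow> 'b :: comm_monoid_add))"
  by (induction A rule: infinite_finite_induct) (auto simp: fun_eq_iff)

lemma linear_combination_in_span:
  fixes g :: "'i \<Rightarrow> 'a \<Rightarrow> real"
  assumes "\<And>i. i \<in> I \<Longrightarrow> g i \<in> fun_space.span S"
  shows "(\<lambda>x. \<Sum>i\<in>I. c i * g i x) \<in> fun_space.span S"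
  unfolding sum_fun_eq using assms by (intro fun_space.span_sum fun_space.span_scale)

lemma spline_space_eq_linear_combinations:
  "s \<in> spline_space p n \<xi> \<longleftrightarrow> (\<exists>c. s = (\<lambda>x. \<Sum>i = 1..n. c i * bspline i p \<xi> x))"
proof
  assume "s \<in> spline_space p n \<xi>"
  then show "\<exists>c. s = (\<lambda>x. \<Sum>i = 1..n. c i * bspline i p \<xi> x)"
    unfolding spline_space_def
  proof (induction rule: fun_space.span_induct_alt)
    case base
    show ?case by (intro exI[of _ "\<lambda>_. 0"]) (auto simp: fun_eq_iff)
  next
    case (step d x y)
    then obtain j c where "j \<in> {1..n}" "x = bspline j p \<xi>" "y = (\<lambda>x. \<Sum>i = 1..n. c i * bspline i p \<xi> x)"
      by auto
    then show ?case
      by (intro exI[of _ "\<lambda>i. (if i = j then d else 0) + c i"])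
        (auto simp: fun_eq_iff algebra_simps sum.distrib if_distrib[of "\<lambda>t. _ * t"] cong: if_cong)
  qed
next
  assume "\<exists>c. s = (\<lambda>x. \<Sum>i = 1..n. c i * bspline i p \<xi> x)"
  then show "s \<in> spline_space p n \<xi>"
    unfolding spline_space_def
    by (elim exE ssubst) (rule linear_combination_in_span, rule fun_space.span_base, blast)
qed

lemma borel_measurable_spline_space: "s \<in> spline_space p n \<xi> \<Longrightarrow> s \<in> borel_measurable borel"
  by (auto simp: spline_space_eq_linear_combinations)

section \<open>Orthonormal B-splines of one random variable\<close>

lemma index_P_vec:
  "k < n \<Longrightarrow> vec_index (P_vec p n \<xi> x) k = (if k = 0 then 1 else bspline (k + 1) p \<xi> x)"
  by (simp add: P_vec_def)

lemma bounded_borel_on_P_vec: "k < n \<Longrightarrow> bounded_borel_on a b (\<lambda>x. vec_index (P_vec p n \<xi> x) k)"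
  using bounded_borel_on_bspline[of a b "k + 1" p \<xi>]
  by (cases "k = 0") (simp_all add: index_P_vec bounded_borel_on_const)

text \<open>
  Replacing \<open>B\<^sub>1\<close> by the constant 1 does not change the span on \<open>[a, b)\<close>, since there 1 is the sum of
  all B-splines. The change of coefficients is invertible, so this equation serves in both
  directions.
\<close>

lemma P_vec_combination:
  assumes knots: "open_knot_sequence p n a b \<xi>" and x: "x \<in> {a..<b}"
  shows "(\<Sum>k<n. e k * vec_index (P_vec p n \<xi> x) k)
    = (\<Sum>i = 1..n. (if i = 1 then e 0 else e (i - 1) + e 0) * bspline i p \<xi> x)"
proof -
  obtain n' where n: "n = Suc n'"
    using knots by (cases n) (auto simp: open_knot_sequence_def)
  have one: "(\<Sum>i = 1..n. bspline i p \<xi> x) = 1"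
    using bspline_sum_eq_1[OF knots] x by auto
  have "(\<Sum>k<n. e k * vec_index (P_vec p n \<xi> x) k) = e 0 + (\<Sum>k<n'. e (Suc k) * bspline (k + 2) p \<xi> x)"
    unfolding n by (subst sum.lessThan_Suc_shift) (simp add: index_P_vec)
  also have "(\<Sum>k<n'. e (Suc k) * bspline (k + 2) p \<xi> x) = (\<Sum>i = 2..n. e (i - 1) * bspline i p \<xi> x)"
    unfolding n by (rule sum.reindex_bij_witness[of _ "\<lambda>i. i - 2" "\<lambda>k. k + 2"]) auto
  also have "e 0 = (\<Sum>i = 1..n. e 0 * bspline i p \<xi> x)"
    using one by (simp add: sum_distrib_left[symmetric])
  also have "\<dots> = e 0 * bspline 1 p \<xi> x + (\<Sum>i = 2..n. e 0 * bspline i p \<xi> x)"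
    by (subst sum.atLeast_Suc_atMost) (auto simp: n numeral_2_eq_2)
  also have "e 0 * bspline 1 p \<xi> x + (\<Sum>i = 2..n. e 0 * bspline i p \<xi> x) + (\<Sum>i
      = 2..n. e (i - 1) * bspline i p \<xi> x)
    = e 0 * bspline 1 p \<xi> x + (\<Sum>i = 2..n. (if i = 1 then e 0 else e (i - 1) + e 0) * bspline i p \<xi> x)"
    by (simp add: sum.distrib[symmetric] algebra_simps)
  also have "\<dots> = (\<Sum>i = 1..n. (if i = 1 then e 0 else e (i - 1) + e 0) * bspline i p \<xi> x)"
    by (subst (2) sum.atLeast_Suc_atMost) (auto simp: n numeral_2_eq_2)
  finally show ?thesis .
qed

locale spline_variable = prob_space M for M :: "'w measure" +
  fixes X :: "'w \<Rightarrow> real" and f :: "real \<Rightarrow> real" and a b :: real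
    and p n :: nat and \<xi> :: "nat \<Rightarrow> real"
  assumes range: "\<And>\<omega>. \<omega> \<in> space M \<Longrightarrow> X \<omega> \<in> {a..b}"
    and density_nonneg: "\<And>x. 0 \<le> f x"
    and density: "distributed M lborel X (\<lambda>x. ennreal (f x))"
    and density_continuous: "continuous_on {a..b} f"
    and density_support: "closure {x. f x \<noteq> 0} = {a..b}"
    and knots: "open_knot_sequence p n a b \<xi>"
begin

lemma random_variable_X [measurable]: "X \<in> borel_measurable M"
  using distributed_measurable[OF density] by simp

lemma AE_density_imp:
  assumes "AE \<omega> in M. P (X \<omega>)" "{x. P x} \<in> sets borel"
  shows "AE x in lborel. f x > 0 \<longrightarrow> P x"
proof -
  have "AE x in distr M lborel X. P x"
    using assms by (subst AE_distr_iff) auto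
  then show ?thesis
    unfolding distributed_distr_eq_density[OF density]
    using AE_density[OF distributed_borel_measurable[OF density]] by simp
qed

lemma AE_in_half_open: "AE \<omega> in M. X \<omega> \<in> {a..<b}"
proof -
  have "AE x in density lborel f. x \<noteq> b"
    using distributed_borel_measurable[OF density] AE_lborel_singleton[of b]
    by (subst AE_density) auto
  then have "AE x in distr M lborel X. x \<noteq> b"
    unfolding distributed_distr_eq_density[OF density] .
  then have "AE \<omega> in M. X \<omega> \<noteq> b" by (subst (asm) AE_distr_iff) auto
  then show ?thesis
    using AE_space by eventually_elim (use range in fastforce)
qed

lemma integrable_bounded_borel:
  assumes "bounded_borel_on a b g"
  shows "integrable M (\<lambda>\<omega>. g (X \<omega>))"
proof -
  obtain K where "\<forall>x\<in>{a..b}. \<bar>g x\<bar> \<le> K" and [measurable]: "g \<in> borel_measurable borel"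
    using assms by (auto simp: bounded_borel_on_def)
  then show ?thesis
    using range by (intro integrable_const_bound[of _ K]) auto
qed

text \<open>
  As the density is continuous with support \<open>[a, b]\<close>, every interval to the right of \<open>z\<close> contains a
  ball on which it is positive. A function without zeros in that interval would be nonzero with
  positive probability.
\<close>

lemma AE_zero_imp_frequently_zero:
  fixes g :: "real \<Rightarrow> real"
  assumes "g \<in> borel_measurable borel" "AE \<omega> in M. g (X \<omega>) = 0" "a \<le> z" "z < b"
  shows "\<exists>\<^sub>F t in at_right z. g t = 0"
  unfolding frequently_def
proof
  assume "\<forall>\<^sub>F t in at_right z. g t \<noteq> 0"
  then obtain e where e: "z < e" "\<And>t. z < t \<Longrightarrow> t < e \<Longrightarrow> g t \<noteq> 0"
    by (auto simp: eventually_at_right_field)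
  define U where "U = {z<..<min e b}"
  have U: "open U" "U \<noteq> {}" "U \<subseteq> {a..b}"
    using assms e by (auto simp: U_def)
  then have "U \<inter> closure {x. f x \<noteq> 0} \<noteq> {}" by (auto simp: density_support)
  then have "U \<inter> {x. f x \<noteq> 0} \<noteq> {}" using U(1) open_Int_closure_eq_empty by blast
  then obtain t where t: "t \<in> U" "f t > 0"
    using density_nonneg by (metis (mono_tags, lifting) IntE ex_in_conv mem_Collect_eq order_le_less)
  have "open (U \<inter> f -` {0<..})"
    using continuous_on_subset[OF density_continuous U(3)] U(1) by (intro continuous_open_preimage) auto
  then have "open (U \<inter> {x. f x > 0})" by (simp add: vimage_def)
  then obtain \<delta> where \<delta>: "\<delta> > 0" "ball t \<delta> \<subseteq> U \<inter> {x. f x > 0}"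
    using t open_contains_ball by (metis (no_types, lifting) IntI mem_Collect_eq)
  have "AE x in lborel. f x > 0 \<longrightarrow> g x = 0"
  proof (intro AE_density_imp assms)
    have "g -` {0} \<inter> space borel \<in> sets borel" using assms(1) by (rule measurable_sets) simp
    then show "{x. g x = 0} \<in> sets borel" by (simp add: vimage_def)
  qed
  then have "AE x in lborel. x \<notin> ball t \<delta>"
    by eventually_elim (use \<delta> e(2) in \<open>auto simp: U_def\<close>)
  then have "emeasure lborel (ball t \<delta>) = 0"
    by (subst (asm) AE_iff_measurable[of "ball t \<delta>"]) auto
  moreover have "ball t \<delta> = {t - \<delta><..<t + \<delta>}" by (auto simp: dist_real_def)
  ultimately show False using \<delta>(1) by simp
qed

abbreviation "G \<equiv> gram_mat M X p n \<xi>"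
abbreviation "Q \<equiv> cholesky G"
abbreviation "R \<equiv> the (mat_inverse Q)"
abbreviation "\<psi> \<equiv> ortho_spline M X p n \<xi>"

lemma gram_carrier: "G \<in> carrier_mat n n"
  by (simp add: gram_mat_def)

lemma gram_entry:
  "i < n \<Longrightarrow> j < n \<Longrightarrow> G $$ (i, j)
    = expectation (\<lambda>\<omega>. vec_index (P_vec p n \<xi> (X \<omega>)) i * vec_index (P_vec p n \<xi> (X \<omega>)) j)"
  by (simp add: gram_mat_def)

lemma expectation_product_combinations:
  "expectation (\<lambda>\<omega>. (\<Sum>k<n. c k * vec_index (P_vec p n \<xi> (X \<omega>)) k) * (\<Sum>l<n. d l * vec_index (P_vec p n \<xi> (X \<omega>)) l))
    = (\<Sum>k<n. \<Sum>l<n. c k * d l * G $$ (k, l))"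
proof -
  have int: "integrable M (\<lambda>\<omega>. vec_index (P_vec p n \<xi> (X \<omega>)) k * vec_index (P_vec p n \<xi> (X \<omega>)) l)"
    if "k < n" "l < n" for k l
    by (rule integrable_bounded_borel[OF bounded_borel_on_mult[OF bounded_borel_on_P_vec
        bounded_borel_on_P_vec]]) fact+
  have "expectation (\<lambda>\<omega>. (\<Sum>k<n. c k * vec_index (P_vec p n \<xi> (X \<omega>)) k) * (\<Sum>l<n. d l * vec_index (P_vec p n \<xi> (X \<omega>)) l))
    = expectation (\<lambda>\<omega>. \<Sum>k<n. \<Sum>l<n. c k * d l * (vec_index (P_vec p n \<xi> (X \<omega>)) k * vec_index (P_vec p n \<xi> (X \<omega>)) l))"
    unfolding sum_product by (simp only: mult_ac)
  also have "\<dots> = (\<Sum>k<n. \<Sum>l<n. c k * d l * G $$ (k, l))"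
    by (subst Bochner_Integration.integral_sum)
      (auto intro!: sum.cong Bochner_Integration.integrable_sum integrable_mult_right int
        simp: Bochner_Integration.integral_sum int gram_entry)
  finally show ?thesis .
qed

text \<open>
  The quadratic form at \<open>c\<close> is the second moment of \<open>\<Sum>\<^sub>k c\<^sub>k P\<^sub>k(X)\<close>. If it were zero, the coefficients
  with respect to the B-splines would vanish by linear independence, and then \<open>c\<close> would vanish too.
\<close>

lemma gram_positive_definite:
  assumes "\<exists>i<n. c i \<noteq> 0"
  shows "(\<Sum>i<n. \<Sum>j<n. c i * c j * G $$ (i, j)) > 0"
proof -
  define h where "h x = (\<Sum>k<n. c k * vec_index (P_vec p n \<xi> x) k)" for x
  have h: "bounded_borel_on a b h"
    unfolding h_def by (intro bounded_borel_on_sum bounded_borel_on_mult bounded_borel_on_const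
        bounded_borel_on_P_vec) auto
  have eq: "(\<Sum>i<n. \<Sum>j<n. c i * c j * G $$ (i, j)) = expectation (\<lambda>\<omega>. h (X \<omega>) * h (X \<omega>))"
    by (simp add: h_def expectation_product_combinations)
  have "expectation (\<lambda>\<omega>. h (X \<omega>) * h (X \<omega>)) \<noteq> 0"
  proof
    assume "expectation (\<lambda>\<omega>. h (X \<omega>) * h (X \<omega>)) = 0"
    then have "AE \<omega> in M. h (X \<omega>) * h (X \<omega>) = 0"
      using integrable_bounded_borel[OF bounded_borel_on_mult[OF h h]]
      by (subst (asm) integral_nonneg_eq_0_iff_AE) auto
    then have ae: "AE \<omega> in M. h (X \<omega>) = 0" by simp
    define d where "d i = (if i = 1 then c 0 else c (i - 1) + c 0)" for i :: nat
    have d: "d i = 0" if "i \<in> {1..n}" for i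
    proof (rule bspline_lin_indep[OF knots _ that])
      fix z assume z: "a \<le> z" "z < b"
      have "\<exists>\<^sub>F t in at_right z. h t = 0"
        using h by (intro AE_zero_imp_frequently_zero[OF _ ae z]) (simp add: bounded_borel_on_def)
      moreover have "\<forall>\<^sub>F t in at_right z. t \<in> {a..<b}"
        unfolding eventually_at_right_field using z by (intro exI[of _ b]) auto
      ultimately have "\<exists>\<^sub>F t in at_right z. t \<in> {a..<b} \<and> h t = 0"
        by (rule frequently_eventually_conj)
      then show "\<exists>\<^sub>F t in at_right z. (\<Sum>i = 1..n. d i * bspline i p \<xi> t) = 0"
        by (rule frequently_elim1) (use P_vec_combination[OF knots, of _ c] in \<open>auto simp: h_def d_def\<close>)
    qed
    obtain i where i: "i < n" "c i \<noteq> 0" using assms by blast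
    have "c 0 = 0" using d[of 1] i by (simp add: d_def)
    then show False using d[of "i + 1"] i by (cases "i = 0") (auto simp: d_def)
  qed
  moreover have "expectation (\<lambda>\<omega>. h (X \<omega>) * h (X \<omega>)) \<ge> 0" by simp
  ultimately show ?thesis unfolding eq by (metis order.not_eq_order_implies_strict)
qed

lemma cholesky_gram: "is_cholesky_factor G Q"
proof (rule cholesky_is_factor[OF gram_carrier])
  show "G $$ (i, j) = G $$ (j, i)" if "i < n" "j < n" for i j
    unfolding gram_entry[OF that] gram_entry[OF that(2,1)] by (subst mult.commute) (rule refl)
qed (rule gram_positive_definite)

lemma ortho_spline_eq:
  assumes "i \<in> {1..n}"
  shows "\<psi> i x = (\<Sum>k<n. R $$ (i - 1, k) * vec_index (P_vec p n \<xi> x) k)"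
proof -
  have "R \<in> carrier_mat n n"
    by (rule cholesky_factor_inverse(1)[OF cholesky_gram gram_carrier])
  moreover have "P_vec p n \<xi> x \<in> carrier_vec n" by (simp add: P_vec_def)
  ultimately show ?thesis
    using assms unfolding ortho_spline_def
    by (subst index_mult_mat_vec) (auto simp: scalar_prod_def lessThan_atLeast0)
qed

lemma bounded_borel_on_ortho_spline: "i \<in> {1..n} \<Longrightarrow> bounded_borel_on a b (\<psi> i)"
  unfolding ext[of "\<psi> i", OF ortho_spline_eq]
  by (intro bounded_borel_on_sum bounded_borel_on_mult bounded_borel_on_const
      bounded_borel_on_P_vec) simp

lemma ortho_spline_orthonormal:
  assumes "i \<in> {1..n}" "j \<in> {1..n}"
  shows "expectation (\<lambda>\<omega>. \<psi> i (X \<omega>) * \<psi> j (X \<omega>)) = (if i = j then 1 else 0)"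
proof -
  have "expectation (\<lambda>\<omega>. \<psi> i (X \<omega>) * \<psi> j (X \<omega>))
    = (\<Sum>k<n. \<Sum>l<n. R $$ (i - 1, k) * R $$ (j - 1, l) * G $$ (k, l))"
    using assms by (simp add: ortho_spline_eq expectation_product_combinations)
  also have "\<dots> = (if i - 1 = j - 1 then 1 else 0)"
    using assms by (intro cholesky_whitening[OF cholesky_gram gram_carrier]) auto
  finally show ?thesis using assms by auto
qed

lemma P_vec_eq_ortho_spline_combination:
  assumes k: "k < n"
  shows "vec_index (P_vec p n \<xi> x) k = (\<Sum>j<n. Q $$ (k, j) * \<psi> (j + 1) x)"
proof -
  note Q = is_cholesky_factorD(1)[OF cholesky_gram gram_carrier]
  note R = cholesky_factor_inverse[OF cholesky_gram gram_carrier]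
  have P: "P_vec p n \<xi> x \<in> carrier_vec n" by (simp add: P_vec_def)
  have "Q *\<^sub>v (R *\<^sub>v P_vec p n \<xi> x) = P_vec p n \<xi> x"
    using assoc_mult_mat_vec[OF Q R(1) P] P by (simp add: R(3))
  then have "vec_index (P_vec p n \<xi> x) k = vec_index (Q *\<^sub>v (R *\<^sub>v P_vec p n \<xi> x)) k" by simp
  also have "\<dots> = (\<Sum>j<n. Q $$ (k, j) * vec_index (R *\<^sub>v P_vec p n \<xi> x) j)"
    using Q R k by (simp add: scalar_prod_def lessThan_atLeast0)
  finally show ?thesis by (simp add: ortho_spline_def)
qed

text \<open>
  The first row of \<open>Q \<psi> = P\<close> reads \<open>Q\<^sub>0\<^sub>0 \<psi>\<^sub>1 = 1\<close>, because \<open>Q\<close> is lower triangular, and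
  \<open>Q\<^sub>0\<^sub>0\<^sup>2 = G\<^sub>0\<^sub>0 = E[1] = 1\<close>.
\<close>

lemma ortho_spline_1: "\<psi> 1 x = 1"
proof -
  have n: "0 < n" using knots by (simp add: open_knot_sequence_def)
  note Q = is_cholesky_factorD[OF cholesky_gram gram_carrier]
  have "(Q $$ (0, 0))\<^sup>2 = G $$ (0, 0)"
    using cholesky_entry[OF cholesky_gram gram_carrier n n] by (simp add: power2_eq_square)
  also have "\<dots> = 1" using n by (simp add: gram_entry index_P_vec prob_space)
  finally have Q0: "Q $$ (0, 0) = 1" using Q(3)[OF n] by (simp add: power2_eq_1_iff)
  have "1 = (\<Sum>j<n. Q $$ (0, j) * \<psi> (j + 1) x)"
    using P_vec_eq_ortho_spline_combination[OF n, of x] n by (simp add: index_P_vec)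
  also have "\<dots> = (\<Sum>j\<in>{0}. Q $$ (0, j) * \<psi> (j + 1) x)"
    using n Q(2) by (intro sum.mono_neutral_right) auto
  finally show ?thesis by (simp add: Q0)
qed

text \<open>
  The point \<open>b\<close> has to be left out: all B-splines vanish there, but \<open>\<psi>\<^sub>1 = 1\<close> does not.
\<close>

lemma spline_eq_ortho_spline_combination:
  assumes "s \<in> spline_space p n \<xi>"
  shows "\<exists>c. \<forall>x\<in>{a..<b}. s x = (\<Sum>i = 1..n. c i * \<psi> i x)"
proof -
  obtain c where s: "s = (\<lambda>x. \<Sum>i = 1..n. c i * bspline i p \<xi> x)"
    using assms by (auto simp: spline_space_eq_linear_combinations)
  \<comment> \<open>The inverse of the change of coefficients in \<open>P_vec_combination\<close>.\<close>
  define e where "e k = (if k = 0 then c 1 else c (k + 1) - c 1)" for k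
  define c' where "c' i = (\<Sum>k<n. e k * Q $$ (k, i - 1))" for i
  have "s x = (\<Sum>i = 1..n. c' i * \<psi> i x)" if "x \<in> {a..<b}" for x
  proof -
    have "s x = (\<Sum>k<n. e k * vec_index (P_vec p n \<xi> x) k)"
      unfolding s P_vec_combination[OF knots that]
      by (intro sum.cong) (auto simp: e_def)
    also have "\<dots> = (\<Sum>k<n. \<Sum>j<n. e k * Q $$ (k, j) * \<psi> (j + 1) x)"
      by (simp add: P_vec_eq_ortho_spline_combination sum_distrib_left mult.assoc)
    also have "\<dots> = (\<Sum>j<n. \<Sum>k<n. e k * Q $$ (k, j) * \<psi> (j + 1) x)" by (rule sum.swap)
    also have "\<dots> = (\<Sum>j<n. c' (j + 1) * \<psi> (j + 1) x)"
      by (simp add: c'_def sum_distrib_right)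
    also have "\<dots> = (\<Sum>i = 1..n. c' i * \<psi> i x)"
      by (rule sum.reindex_bij_witness[of _ "\<lambda>i. i - 1" "\<lambda>k. k + 1"]) auto
    finally show ?thesis .
  qed
  then show ?thesis by blast
qed

lemma ortho_spline_eq_spline:
  assumes "i \<in> {1..n}"
  shows "\<exists>s\<in>spline_space p n \<xi>. \<forall>x\<in>{a..<b}. \<psi> i x = s x"
  unfolding Bex_def spline_space_eq_linear_combinations ortho_spline_eq[OF assms]
  using P_vec_combination[OF knots, of _ "\<lambda>k. R $$ (i - 1, k)"] by (intro exI conjI ballI) auto

end

section \<open>Orthogonal projections by Fourier coefficients\<close>

lemma square_integrable_mult:
  assumes "square_integrable M Y" "square_integrable M Z"
  shows "integrable M (\<lambda>\<omega>. Y \<omega> * Z \<omega> :: real)"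
proof (rule Bochner_Integration.integrable_bound)
  show "integrable M (\<lambda>\<omega>. (Y \<omega>)\<^sup>2 + (Z \<omega>)\<^sup>2)"
    using assms by (simp add: square_integrable_def)
  show "(\<lambda>\<omega>. Y \<omega> * Z \<omega>) \<in> borel_measurable M"
    using assms by (auto simp: square_integrable_def intro!: borel_measurable_times)
  have "\<bar>y * z\<bar> \<le> y\<^sup>2 + z\<^sup>2" for y z :: real
  proof -
    have "2 * (\<bar>y\<bar> * \<bar>z\<bar>) \<le> y\<^sup>2 + z\<^sup>2"
      using sum_squares_bound[of "\<bar>y\<bar>" "\<bar>z\<bar>"] by (simp add: mult.assoc)
    moreover have "0 \<le> \<bar>y\<bar> * \<bar>z\<bar>" by simp
    ultimately show ?thesis unfolding abs_mult by linarith
  qed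
  then show "AE \<omega> in M. norm (Y \<omega> * Z \<omega>) \<le> norm ((Y \<omega>)\<^sup>2 + (Z \<omega>)\<^sup>2)"
    by (simp add: abs_of_nonneg[OF sum_power2_ge_zero])
qed

lemma square_integrable_scale: "square_integrable M Y \<Longrightarrow> square_integrable M (\<lambda>\<omega>. c * Y \<omega>)"
  by (auto simp: square_integrable_def power_mult_distrib)

lemma square_integrable_add:
  assumes "square_integrable M Y" "square_integrable M Z"
  shows "square_integrable M (\<lambda>\<omega>. Y \<omega> + Z \<omega>)"
proof -
  have "integrable M (\<lambda>\<omega>. (Y \<omega>)\<^sup>2 + (Z \<omega>)\<^sup>2 + 2 * (Y \<omega> * Z \<omega>))"
    using assms square_integrable_mult[OF assms]
    by (intro Bochner_Integration.integrable_add integrable_mult_right) (auto simp: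
        square_integrable_def)
  then show ?thesis
    using assms by (auto simp: square_integrable_def power2_sum mult.assoc intro!: borel_measurable_add)
qed

lemma square_integrable_linear_combination:
  assumes "\<And>i. i \<in> I \<Longrightarrow> square_integrable M (g i)"
  shows "square_integrable M (\<lambda>\<omega>. \<Sum>i\<in>I. c i * g i \<omega>)"
  using assms
  by (induction I rule: infinite_finite_induct)
    (auto intro!: square_integrable_add square_integrable_scale, auto simp: square_integrable_def)

text \<open>
  A finite orthonormal family that spans the set \<open>V\<close> of random variables up to almost sure equality.
  \<open>V\<close> consists of functions rather than equivalence classes, so spanning splits into the two
  assumptions \<open>V_expansion\<close> and \<open>V_contains\<close>.
\<close>

locale orthonormal_family =
  fixes M :: "'w measure" and I :: "'i set" and \<phi> :: "'i \<Rightarrow> 'w \<Rightarrow> real" and V :: "('w \<Rightarrow> real) set"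
  assumes finite_I: "finite I"
    and square_integrable_\<phi>: "\<And>i. i \<in> I \<Longrightarrow> square_integrable M (\<phi> i)"
    and orthonormal: "\<And>i j. i \<in> I \<Longrightarrow> j \<in> I \<Longrightarrow> (\<integral>\<omega>. \<phi> i \<omega> * \<phi> j \<omega> \<partial>M) = (if i = j then 1 else 0)"
    and V_measurable: "\<And>s. s \<in> V \<Longrightarrow> s \<in> borel_measurable M"
    and V_expansion: "\<And>s. s \<in> V \<Longrightarrow> \<exists>c. AE \<omega> in M. s \<omega> = (\<Sum>i\<in>I. c i * \<phi> i \<omega>)"
    and V_contains: "\<And>c. \<exists>s\<in>V. AE \<omega> in M. (\<Sum>i\<in>I. c i * \<phi> i \<omega>) = s \<omega>"
begin

lemma integral_combination_mult:
  assumes j: "j \<in> I"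
  shows "(\<integral>\<omega>. (\<Sum>i\<in>I. c i * \<phi> i \<omega>) * \<phi> j \<omega> \<partial>M) = c j"
proof -
  have int: "integrable M (\<lambda>\<omega>. \<phi> i \<omega> * \<phi> j \<omega>)" if "i \<in> I" for i
    by (intro square_integrable_mult square_integrable_\<phi> that j)
  have "(\<integral>\<omega>. (\<Sum>i\<in>I. c i * \<phi> i \<omega>) * \<phi> j \<omega> \<partial>M) = (\<integral>\<omega>. (\<Sum>i\<in>I. c i * (\<phi> i \<omega> * \<phi> j \<omega>)) \<partial>M)"
    by (simp add: sum_distrib_right mult.assoc)
  also have "\<dots> = (\<Sum>i\<in>I. c i * (\<integral>\<omega>. \<phi> i \<omega> * \<phi> j \<omega> \<partial>M))"
    using int by (subst Bochner_Integration.integral_sum) auto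
  also have "\<dots> = (\<Sum>i\<in>I. if i = j then c i else 0)"
    using j by (intro sum.cong) (auto simp: orthonormal)
  also have "\<dots> = c j" using finite_I j by simp
  finally show ?thesis .
qed

lemma fourier_sum_is_orth_projection:
  assumes Y: "square_integrable M Y"
  shows "is_orth_projection M V Y (\<lambda>\<omega>. \<Sum>i\<in>I. (\<integral>\<omega>. Y \<omega> * \<phi> i \<omega> \<partial>M) * \<phi> i \<omega>)"
proof -
  define c where "c i = (\<integral>\<omega>. Y \<omega> * \<phi> i \<omega> \<partial>M)" for i
  define Z where "Z \<omega> = (\<Sum>i\<in>I. c i * \<phi> i \<omega>)" for \<omega>
  have Z: "square_integrable M Z"
    unfolding Z_def by (intro square_integrable_linear_combination square_integrable_\<phi>)
  have ortho: "has_bochner_integral M (\<lambda>\<omega>. (Y \<omega> - Z \<omega>) * \<phi> j \<omega>) 0" if j: "j \<in> I" for j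
  proof -
    note int = square_integrable_mult[OF Y square_integrable_\<phi>[OF j]] square_integrable_mult[OF Z
        square_integrable_\<phi>[OF j]]
    have "has_bochner_integral M (\<lambda>\<omega>. Y \<omega> * \<phi> j \<omega> - Z \<omega> * \<phi> j \<omega>) (c j - c j)"
      using has_bochner_integral_diff[OF has_bochner_integral_integrable[OF int(1)]
          has_bochner_integral_integrable[OF int(2)]]
        integral_combination_mult[OF j, of c] by (simp add: Z_def c_def)
    then show ?thesis by (simp add: left_diff_distrib)
  qed
  have "has_bochner_integral M (\<lambda>\<omega>. (Y \<omega> - Z \<omega>) * s \<omega>) 0" if s: "s \<in> V" for s
  proof -
    obtain d where d: "AE \<omega> in M. s \<omega> = (\<Sum>i\<in>I. d i * \<phi> i \<omega>)" using V_expansion[OF s] by blast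
    have "has_bochner_integral M (\<lambda>\<omega>. \<Sum>i\<in>I. d i * ((Y \<omega> - Z \<omega>) * \<phi> i \<omega>)) (\<Sum>i\<in>I. d i * 0)"
      by (intro has_bochner_integral_sum has_bochner_integral_mult_right ortho)
    then have *: "has_bochner_integral M (\<lambda>\<omega>. \<Sum>i\<in>I. d i * ((Y \<omega> - Z \<omega>) * \<phi> i \<omega>)) 0" by simp
    show ?thesis
    proof (subst has_bochner_integral_cong_AE)
      show "(\<lambda>\<omega>. (Y \<omega> - Z \<omega>) * s \<omega>) \<in> borel_measurable M"
        using Y Z V_measurable[OF s] by (auto simp: square_integrable_def)
      show "(\<lambda>\<omega>. \<Sum>i\<in>I. d i * ((Y \<omega> - Z \<omega>) * \<phi> i \<omega>)) \<in> borel_measurable M"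
        using * by (rule borel_measurable_has_bochner_integral)
      show "AE \<omega> in M. (Y \<omega> - Z \<omega>) * s \<omega> = (\<Sum>i\<in>I. d i * ((Y \<omega> - Z \<omega>) * \<phi> i \<omega>))"
        using d by eventually_elim (simp add: sum_distrib_left mult_ac)
    qed fact
  qed
  moreover have "\<exists>s\<in>V. AE \<omega> in M. Z \<omega> = s \<omega>"
    unfolding Z_def by (rule V_contains)
  ultimately show ?thesis
    using Z unfolding is_orth_projection_def Z_def c_def by blast
qed

text \<open>
  A projection \<open>Z\<close> is almost surely a combination of the \<open>\<phi>\<^sub>i\<close>, and testing the orthogonality of
  \<open>Y - Z\<close> against (a version of) \<open>\<phi>\<^sub>j\<close> identifies its \<open>j\<close>-th coefficient.
\<close>

lemma orth_projection_unique:
  assumes Y: "square_integrable M Y" and Z: "is_orth_projection M V Y Z"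
  shows "AE \<omega> in M. Z \<omega> = (\<Sum>i\<in>I. (\<integral>\<omega>. Y \<omega> * \<phi> i \<omega> \<partial>M) * \<phi> i \<omega>)"
proof -
  have Zsq: "square_integrable M Z" and ortho: "\<And>s. s \<in> V \<Longrightarrow>
      has_bochner_integral M (\<lambda>\<omega>. (Y \<omega> - Z \<omega>) * s \<omega>) 0"
    using Z by (auto simp: is_orth_projection_def)
  obtain s where s: "s \<in> V" "AE \<omega> in M. Z \<omega> = s \<omega>" using Z by (auto simp: is_orth_projection_def)
  obtain c where c: "AE \<omega> in M. s \<omega> = (\<Sum>i\<in>I. c i * \<phi> i \<omega>)" using V_expansion[OF s(1)] by blast
  have Zc: "AE \<omega> in M. Z \<omega> = (\<Sum>i\<in>I. c i * \<phi> i \<omega>)" using s(2) c by eventually_elim simp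
  have [measurable]: "Y \<in> borel_measurable M" "Z \<in> borel_measurable M"
    and \<phi>[measurable]: "\<And>i. i \<in> I \<Longrightarrow> \<phi> i \<in> borel_measurable M"
    using Y Zsq square_integrable_\<phi> by (auto simp: square_integrable_def)
  have "c j = (\<integral>\<omega>. Y \<omega> * \<phi> j \<omega> \<partial>M)" if j: "j \<in> I" for j
  proof -
    have "(\<Sum>i\<in>I. (if i = j then 1 else 0) * \<phi> i \<omega>) = \<phi> j \<omega>" for \<omega>
      using finite_I j by (simp add: if_distrib[of "\<lambda>t. t * _"] cong: if_cong)
    then obtain t where t: "t \<in> V" "AE \<omega> in M. \<phi> j \<omega> = t \<omega>"
      using V_contains[of "\<lambda>i. if i = j then 1 else 0"] by auto
    have "(\<integral>\<omega>. (Y \<omega> - Z \<omega>) * \<phi> j \<omega> \<partial>M) = (\<integral>\<omega>. (Y \<omega> - Z \<omega>) * t \<omega> \<partial>M)"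
      using t V_measurable[OF t(1)] \<phi>[OF j] by (intro integral_cong_AE) auto
    also have "\<dots> = 0" using ortho[OF t(1)] by (rule has_bochner_integral_integral_eq)
    finally have "(\<integral>\<omega>. Y \<omega> * \<phi> j \<omega> \<partial>M) = (\<integral>\<omega>. Z \<omega> * \<phi> j \<omega> \<partial>M)"
      using square_integrable_mult[OF Y square_integrable_\<phi>[OF j]] square_integrable_mult[OF Zsq
          square_integrable_\<phi>[OF j]]
      by (simp add: left_diff_distrib)
    also have "\<dots> = (\<integral>\<omega>. (\<Sum>i\<in>I. c i * \<phi> i \<omega>) * \<phi> j \<omega> \<partial>M)"
      using Zc \<phi> \<phi>[OF j] by (intro integral_cong_AE) auto
    also have "\<dots> = c j" by (rule integral_combination_mult[OF j])
    finally show ?thesis by simp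
  qed
  then show ?thesis using Zc by simp
qed

end

section \<open>Joint density of independent variables\<close>

text \<open>
  The joint law of independent variables is the product of the marginal laws, and the measure with
  density \<open>\<Prod>\<^sub>k f\<^sub>k(x\<^sub>k)\<close> agrees with that product on boxes, which determine it.
\<close>

lemma (in prob_space) distributed_joint_density:
  fixes X :: "'i \<Rightarrow> 'a \<Rightarrow> real" and f :: "'i \<Rightarrow> real \<Rightarrow> real"
  assumes I: "finite I" "I \<noteq> {}"
    and indep: "indep_vars (\<lambda>_. borel) X I"
    and f: "\<And>k. k \<in> I \<Longrightarrow> distributed M lborel (X k) (\<lambda>x. ennreal (f k x))"
    and nonneg: "\<And>k x. k \<in> I \<Longrightarrow> 0 \<le> f k x"
  shows "distributed M (\<Pi>\<^sub>M k\<in>I. lborel) (\<lambda>\<omega>. \<lambda>k\<in>I. X k \<omega>) (\<lambda>x. ennreal (\<Prod>k\<in>I. f k (x k)))"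
proof -
  have rv: "X k \<in> borel_measurable M" if "k \<in> I" for k
    using distributed_measurable[OF f[OF that]] by simp
  have fm: "f k \<in> borel_measurable borel" if "k \<in> I" for k
    using distributed_real_measurable[OF _ f[OF that]] nonneg[OF that] by simp
  have sets_eq: "sets (\<Pi>\<^sub>M k\<in>I. lborel) = sets (\<Pi>\<^sub>M k\<in>I. (borel :: real measure))"
    by (rule sets_PiM_cong) auto
  have meas: "(\<lambda>\<omega>. \<lambda>k\<in>I. X k \<omega>) \<in> M \<rightarrow>\<^sub>M (\<Pi>\<^sub>M k\<in>I. lborel)"
    using rv by (intro measurable_restrict) auto
  have F: "(\<lambda>x. ennreal (\<Prod>k\<in>I. f k (x k))) \<in> borel_measurable (\<Pi>\<^sub>M k\<in>I. lborel)"
  proof (intro measurable_compose[OF _ measurable_ennreal] borel_measurable_prod)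
    fix k assume k: "k \<in> I"
    have "(\<lambda>x. x k) \<in> (\<Pi>\<^sub>M k\<in>I. lborel) \<rightarrow>\<^sub>M (borel :: real measure)"
      using measurable_component_singleton[OF k, of "\<lambda>_. lborel"] by simp
    then show "(\<lambda>x. f k (x k)) \<in> borel_measurable (\<Pi>\<^sub>M k\<in>I. lborel)"
      using fm[OF k] by (rule measurable_compose)
  qed
  \<comment> \<open>Outside \<open>I\<close> any \<open>\<sigma>\<close>-finite measure will do; it only makes \<open>D\<close> a total family.\<close>
  define D where "D k = (if k \<in> I then density lborel (\<lambda>x. ennreal (f k x)) else lborel)" for k
  have D: "D k = density lborel (\<lambda>x. ennreal (f k x))" if "k \<in> I" for k
    using that by (simp add: D_def)
  have sf: "sigma_finite_measure (D k)" for k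
  proof (cases "k \<in> I")
    case True
    have "prob_space (distr M lborel (X k))" using rv[OF True] by (intro prob_space_distr) simp
    then have "prob_space (D k)"
      unfolding D[OF True] distributed_distr_eq_density[OF f[OF True]] .
    then show ?thesis by (intro finite_measure.sigma_finite_measure prob_space.finite_measure)
  next
    case False
    then show ?thesis by (simp add: D_def lborel.sigma_finite_measure_axioms)
  qed
  interpret P: product_sigma_finite D by (rule product_sigma_finite.intro) (rule sf)
  interpret L: product_sigma_finite "\<lambda>_::'i. lborel :: real measure"
    by (rule product_sigma_finite.intro) (rule lborel.sigma_finite_measure_axioms)
  have "density (\<Pi>\<^sub>M k\<in>I. lborel) (\<lambda>x. ennreal (\<Prod>k\<in>I. f k (x k))) = PiM I D"
  proof (rule P.PiM_eqI[OF I(1)])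
    show "sets (density (\<Pi>\<^sub>M k\<in>I. lborel) (\<lambda>x. ennreal (\<Prod>k\<in>I. f k (x k)))) = sets (PiM I D)"
      by (simp, intro sets_PiM_cong) (auto simp: D)
    fix A assume A: "\<And>k. k \<in> I \<Longrightarrow> A k \<in> sets (D k)"
    then have A': "A k \<in> sets borel" if "k \<in> I" for k using that by (simp add: D)
    have "emeasure (density (\<Pi>\<^sub>M k\<in>I. lborel) (\<lambda>x. ennreal (\<Prod>k\<in>I. f k (x k)))) (Pi\<^sub>E I A)
      = (\<integral>\<^sup>+x. ennreal (\<Prod>k\<in>I. f k (x k)) * indicator (Pi\<^sub>E I A) x \<partial>(\<Pi>\<^sub>M k\<in>I. lborel))"
      using A' by (intro emeasure_density F sets_PiM_I_finite I) auto
    also have "\<dots> = (\<integral>\<^sup>+x. (\<Prod>k\<in>I. ennreal (f k (x k)) * indicator (A k) (x k)) \<partial>(\<Pi>\<^sub>M k\<in>I. lborel))"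
    proof (intro nn_integral_cong)
      fix x :: "'i \<Rightarrow> real" assume "x \<in> space (\<Pi>\<^sub>M k\<in>I. lborel)"
      then have "(indicator (Pi\<^sub>E I A) x :: ennreal) = (\<Prod>k\<in>I. indicator (A k) (x k))"
        using I(1) by (auto simp: space_PiM indicator_def PiE_iff prod_zero_iff)
      then show "ennreal (\<Prod>k\<in>I. f k (x k)) * indicator (Pi\<^sub>E I A) x
        = (\<Prod>k\<in>I. ennreal (f k (x k)) * indicator (A k) (x k))"
        using nonneg by (simp add: prod.distrib prod_ennreal)
    qed
    also have "\<dots> = (\<Prod>k\<in>I. \<integral>\<^sup>+t. ennreal (f k t) * indicator (A k) t \<partial>lborel)"
      using fm A' by (intro L.product_nn_integral_prod I) auto
    also have "\<dots> = (\<Prod>k\<in>I. emeasure (D k) (A k))"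
      using fm A' by (intro prod.cong) (auto simp: D emeasure_density)
    finally show "emeasure (density (\<Pi>\<^sub>M k\<in>I. lborel) (\<lambda>x. ennreal (\<Prod>k\<in>I. f k (x k)))) (Pi\<^sub>E I A)
      = (\<Prod>k\<in>I. emeasure (D k) (A k))" .
  qed
  moreover have "distr M (\<Pi>\<^sub>M k\<in>I. lborel) (\<lambda>\<omega>. \<lambda>k\<in>I. X k \<omega>) = PiM I D"
  proof -
    have "distr M (\<Pi>\<^sub>M k\<in>I. lborel) (\<lambda>\<omega>. \<lambda>k\<in>I. X k \<omega>)
      = distr M (\<Pi>\<^sub>M k\<in>I. borel) (\<lambda>\<omega>. \<lambda>k\<in>I. X k \<omega>)"
      by (rule distr_cong) (auto simp: sets_eq)
    also have "\<dots> = (\<Pi>\<^sub>M k\<in>I. distr M borel (X k))"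
      using indep_vars_iff_distr_eq_PiM'[OF I(2), of X "\<lambda>_. borel"] rv indep by blast
    also have "\<dots> = PiM I D"
    proof (rule PiM_cong[OF refl])
      fix k assume k: "k \<in> I"
      have "distr M borel (X k) = distr M lborel (X k)" by (rule distr_cong) auto
      then show "distr M borel (X k) = D k"
        unfolding D[OF k] distributed_distr_eq_density[OF f[OF k]] .
    qed
    finally show ?thesis .
  qed
  ultimately show ?thesis using F meas by (simp only: distributed_def simp_thms)
qed

section \<open>Orthonormal tensor products\<close>

locale spline_vector = prob_space M for M :: "'w measure" +
  fixes N :: nat and X :: "nat \<Rightarrow> 'w \<Rightarrow> real" and f :: "nat \<Rightarrow> real \<Rightarrow> real" and a b :: "nat \<Rightarrow> real"
    and p n :: "nat \<Rightarrow> nat" and \<xi> :: "nat \<Rightarrow> nat \<Rightarrow> real"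
  assumes N_pos: "1 \<le> N"
    and indep: "indep_vars (\<lambda>_. borel) X {1..N}"
    and marginal: "\<And>k. k \<in> {1..N} \<Longrightarrow> spline_variable M (X k) (f k) (a k) (b k) (p k) (n k) (\<xi> k)"
begin

abbreviation "\<psi> k \<equiv> ortho_spline M (X k) (p k) (n k) (\<xi> k)"
abbreviation "\<Psi> \<equiv> multi_ortho_spline M X p n \<xi>"
abbreviation "full_index_set \<equiv> (\<Pi>\<^sub>E k\<in>{1..N}. {1..n k})"

lemma rand_vec_component: "k \<in> {1..N} \<Longrightarrow> rand_vec N X \<omega> k = X k \<omega>"
  by (simp add: rand_vec_def)

lemma borel_measurable_component: "k \<in> {1..N} \<Longrightarrow> X k \<in> borel_measurable M"
  by (rule spline_variable.random_variable_X[OF marginal])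

lemma borel_measurable_ortho_spline:
  "k \<in> {1..N} \<Longrightarrow> i \<in> {1..n k} \<Longrightarrow> \<psi> k i \<in> borel_measurable borel"
  using spline_variable.bounded_borel_on_ortho_spline[OF marginal] by (simp add: bounded_borel_on_def)

lemma
  assumes "\<And>k. k \<in> {1..N} \<Longrightarrow> bounded_borel_on (a k) (b k) (h k)"
  shows integrable_product: "integrable M (\<lambda>\<omega>. \<Prod>k\<in>{1..N}. h k (X k \<omega>))"
    and expectation_product: "expectation (\<lambda>\<omega>. \<Prod>k\<in>{1..N}. h k (X k \<omega>))
        = (\<Prod>k\<in>{1..N}. expectation (\<lambda>\<omega>. h k (X k \<omega>)))"
proof -
  have "indep_vars (\<lambda>_. borel) (\<lambda>k \<omega>. h k (X k \<omega>)) {1..N}"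
    using assms by (intro indep_vars_compose2[OF indep]) (auto simp: bounded_borel_on_def)
  moreover have "integrable M (\<lambda>\<omega>. h k (X k \<omega>))" if "k \<in> {1..N}" for k
    by (rule spline_variable.integrable_bounded_borel[OF marginal[OF that] assms[OF that]])
  ultimately show "integrable M (\<lambda>\<omega>. \<Prod>k\<in>{1..N}. h k (X k \<omega>))"
    "expectation (\<lambda>\<omega>. \<Prod>k\<in>{1..N}. h k (X k \<omega>)) = (\<Prod>k\<in>{1..N}. expectation (\<lambda>\<omega>. h k (X k \<omega>)))"
    by (intro indep_vars_integrable indep_vars_lebesgue_integral finite_atLeastAtMost; blast)+
qed

lemma multi_ortho_spline_rand_vec:
  "u \<subseteq> {1..N} \<Longrightarrow> \<Psi> u i (rand_vec N X \<omega>) = (\<Prod>k\<in>u. \<psi> k (i k) (X k \<omega>))"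
  unfolding multi_ortho_spline_def by (intro prod.cong) (auto simp: rand_vec_component)

lemma full_products_orthonormal:
  assumes i: "i \<in> full_index_set" and j: "j \<in> full_index_set"
  shows "expectation (\<lambda>\<omega>. \<Psi> {1..N} i (rand_vec N X \<omega>) * \<Psi> {1..N} j (rand_vec N X \<omega>)) = (if i
      = j then 1 else 0)"
proof -
  have ij: "i k \<in> {1..n k}" "j k \<in> {1..n k}" if "k \<in> {1..N}" for k
    using i j that by (auto dest: PiE_mem)
  have "expectation (\<lambda>\<omega>. \<Psi> {1..N} i (rand_vec N X \<omega>) * \<Psi> {1..N} j (rand_vec N X \<omega>))
    = expectation (\<lambda>\<omega>. \<Prod>k\<in>{1..N}. \<psi> k (i k) (X k \<omega>) * \<psi> k (j k) (X k \<omega>))"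
    by (simp add: multi_ortho_spline_rand_vec prod.distrib)
  also have "\<dots> = (\<Prod>k\<in>{1..N}. expectation (\<lambda>\<omega>. \<psi> k (i k) (X k \<omega>) * \<psi> k (j k) (X k \<omega>)))"
    by (intro expectation_product bounded_borel_on_mult
      spline_variable.bounded_borel_on_ortho_spline[OF marginal] ij)
  also have "\<dots> = (\<Prod>k\<in>{1..N}. if i k = j k then 1 else 0)"
    by (intro prod.cong refl spline_variable.ortho_spline_orthonormal[OF marginal] ij)
  also have "\<dots> = (if i = j then 1 else 0)"
  proof (cases "i = j")
    case False
    then obtain k where "k \<in> {1..N}" "i k \<noteq> j k" using PiE_ext[OF i j] by blast
    then have "(\<Prod>k\<in>{1..N}. if i k = j k then 1 else 0 :: real) = 0" by (intro prod_zero) auto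
    then show ?thesis using False by simp
  qed simp
  finally show ?thesis .
qed

lemma full_product_square_integrable:
  assumes i: "i \<in> full_index_set"
  shows "square_integrable M (\<lambda>\<omega>. \<Psi> {1..N} i (rand_vec N X \<omega>))"
proof -
  have mem: "i k \<in> {1..n k}" if "k \<in> {1..N}" for k
    using i that by (auto dest: PiE_mem)
  have "integrable M (\<lambda>\<omega>. \<Prod>k\<in>{1..N}. \<psi> k (i k) (X k \<omega>) * \<psi> k (i k) (X k \<omega>))"
    by (intro integrable_product bounded_borel_on_mult
      spline_variable.bounded_borel_on_ortho_spline[OF marginal] mem)
  moreover have "(\<lambda>\<omega>. \<Prod>k\<in>{1..N}. \<psi> k (i k) (X k \<omega>)) \<in> borel_measurable M"
    by (intro borel_measurable_prod measurable_compose[OF borel_measurable_component borel_measurable_ortho_spline] mem)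
  ultimately show ?thesis
    by (simp add: square_integrable_def multi_ortho_spline_rand_vec prod.distrib power2_eq_square)
qed

text \<open>
  Pads a multi-index on \<open>u\<close> with 1, the index of the constant function.
\<close>

definition extend_index :: "nat set \<Rightarrow> (nat \<Rightarrow> nat) \<Rightarrow> nat \<Rightarrow> nat" where
  "extend_index u i = (\<lambda>k\<in>{1..N}. if k \<in> u then i k else 1)"

lemma n_pos: "k \<in> {1..N} \<Longrightarrow> 1 \<le> n k"
  using spline_variable.knots[OF marginal] by (fastforce simp: open_knot_sequence_def)

lemma extend_index_in_full:
  assumes "u \<subseteq> {1..N}" "i \<in> reduced_index_set n u"
  shows "extend_index u i \<in> full_index_set"
  using assms n_pos by (fastforce simp: extend_index_def reduced_index_set_def PiE_iff)

lemma multi_ortho_spline_extend_index: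
  assumes u: "u \<subseteq> {1..N}"
  shows "\<Psi> {1..N} (extend_index u i) = \<Psi> u i"
proof
  fix x
  have "\<psi> k 1 t = 1" if "k \<in> {1..N}" for k t
    by (rule spline_variable.ortho_spline_1[OF marginal[OF that]])
  then have "\<Psi> {1..N} (extend_index u i) x = (\<Prod>k\<in>{1..N}. if k \<in> u then \<psi> k (i k) (x k) else 1)"
    unfolding multi_ortho_spline_def by (intro prod.cong) (auto simp: extend_index_def)
  also have "\<dots> = (\<Prod>k\<in>{1..N} \<inter> u. \<psi> k (i k) (x k))"
    by (rule prod.inter_restrict[symmetric]) simp
  also have "{1..N} \<inter> u = u" using u by blast
  finally show "\<Psi> {1..N} (extend_index u i) x = \<Psi> u i x" by (simp add: multi_ortho_spline_def)
qed

text \<open>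
  Every full multi-index is the padding of exactly one reduced multi-index, namely of its restriction
  to the set of positions where it differs from 1. The empty set contributes the empty product. The
  summand \<open>F\<close> may depend on the basis function in any way, so the rearrangement covers
  the Fourier coefficients as well as the functions.
\<close>

lemma sum_full_index_set:
  "(\<Sum>i\<in>full_index_set. F (\<Psi> {1..N} i))
    = F (\<lambda>_. 1) + (\<Sum>u\<in>Pow {1..N} - {{}}. \<Sum>i\<in>reduced_index_set n u. F (\<Psi> u i))"
proof -
  have fin: "finite (reduced_index_set n u)" if "u \<in> Pow {1..N}" for u
    using that unfolding reduced_index_set_def by (intro finite_PiE) (auto intro: finite_subset)
  have "(\<Sum>(u, i)\<in>Sigma (Pow {1..N}) (reduced_index_set n). F (\<Psi> u i))
      = (\<Sum>i\<in>full_index_set. F (\<Psi> {1..N} i))"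
  proof (rule sum.reindex_bij_witness[of _
        "\<lambda>j. ({k \<in> {1..N}. j k \<noteq> 1}, restrict j {k \<in> {1..N}. j k \<noteq> 1})" "\<lambda>(u, i). extend_index u i"])
    fix c assume c: "c \<in> Sigma (Pow {1..N}) (reduced_index_set n)"
    obtain u i where ui: "c = (u, i)" by (cases c)
    with c have u: "u \<subseteq> {1..N}" and i: "i \<in> reduced_index_set n u" by auto
    have ge: "2 \<le> i k" if "k \<in> u" for k using i that by (auto simp: reduced_index_set_def PiE_iff)
    have supp: "{k \<in> {1..N}. extend_index u i k \<noteq> 1} = u"
      using u ge by (force simp: extend_index_def)
    have "restrict (extend_index u i) u = i"
    proof (rule PiE_ext[of _ u])
      show "restrict (extend_index u i) u \<in> Pi\<^sub>E u (\<lambda>_. UNIV)" "i \<in> Pi\<^sub>E u (\<lambda>_. UNIV)"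
        using i by (auto simp: reduced_index_set_def PiE_iff)
    qed (use u in \<open>auto simp: extend_index_def\<close>)
    then show "({k \<in> {1..N}. (case c of (u, i) \<Rightarrow> extend_index u i) k \<noteq> 1},
        restrict (case c of (u, i) \<Rightarrow> extend_index u i) {k \<in> {1..N}. (case c of (u, i) \<Rightarrow> extend_index u i) k \<noteq> 1}) = c"
      unfolding ui prod.case supp by simp
    show "(case c of (u, i) \<Rightarrow> extend_index u i) \<in> full_index_set"
      unfolding ui prod.case by (rule extend_index_in_full[OF u i])
    show "F (\<Psi> {1..N} (case c of (u, i) \<Rightarrow> extend_index u i)) = (case c of (u, i) \<Rightarrow> F (\<Psi> u i))"
      unfolding ui prod.case multi_ortho_spline_extend_index[OF u] ..
  next
    fix j assume j: "j \<in> full_index_set"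
    show "(case ({k \<in> {1..N}. j k \<noteq> 1}, restrict j {k \<in> {1..N}. j k \<noteq> 1}) of (u, i) \<Rightarrow> extend_index u i) = j"
      unfolding prod.case
    proof (rule PiE_ext[OF _ j])
      show "extend_index {k \<in> {1..N}. j k \<noteq> 1} (restrict j {k \<in> {1..N}. j k \<noteq> 1}) \<in> full_index_set"
        using j n_pos by (fastforce simp: extend_index_def PiE_iff)
    qed (auto simp: extend_index_def)
    show "({k \<in> {1..N}. j k \<noteq> 1}, restrict j {k \<in> {1..N}. j k \<noteq> 1})
        \<in> Sigma (Pow {1..N}) (reduced_index_set n)"
    proof (intro SigmaI)
      have "restrict j {k \<in> {1..N}. j k \<noteq> 1} k \<in> {2..n k}" if "k \<in> {k \<in> {1..N}. j k \<noteq> 1}" for k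
        using PiE_mem[OF j, of k] that by auto
      then show "restrict j {k \<in> {1..N}. j k \<noteq> 1} \<in> reduced_index_set n {k \<in> {1..N}. j k \<noteq> 1}"
        unfolding reduced_index_set_def by (intro PiE_I) auto
    qed auto
  qed
  then have "(\<Sum>i\<in>full_index_set. F (\<Psi> {1..N} i)) = (\<Sum>u\<in>Pow {1..N}. \<Sum>i\<in>reduced_index_set n u. F (\<Psi> u i))"
    using fin by (subst sum.Sigma) auto
  also have "\<dots> = (\<Sum>i\<in>reduced_index_set n {}. F (\<Psi> {} i)) + (\<Sum>u\<in>Pow {1..N} - {{}}. \<Sum>i\<in>reduced_index_set n u. F (\<Psi> u i))"
    by (rule sum.remove) auto
  also have "(\<Sum>i\<in>reduced_index_set n {}. F (\<Psi> {} i)) = F (\<lambda>_. 1)"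
    by (simp add: reduced_index_set_def multi_ortho_spline_def[abs_def])
  finally show ?thesis .
qed

lemma AE_components_half_open: "AE \<omega> in M. \<forall>k\<in>{1..N}. X k \<omega> \<in> {a k..<b k}"
  by (intro AE_finite_allI spline_variable.AE_in_half_open[OF marginal]) auto

lemma tensor_spline_measurable:
  assumes "s \<in> tensor_spline_space N p n \<xi>"
  shows "(\<lambda>\<omega>. s (rand_vec N X \<omega>)) \<in> borel_measurable M"
  using assms unfolding tensor_spline_space_def
proof (induction rule: fun_space.span_induct_alt)
  case (step c s t)
  then obtain g where s: "s = (\<lambda>x. \<Prod>k\<in>{1..N}. g k (x k))"
      and g: "\<forall>k\<in>{1..N}. g k \<in> spline_space (p k) (n k) (\<xi> k)"
    by auto
  have "(\<lambda>\<omega>. \<Prod>k\<in>{1..N}. g k (X k \<omega>)) \<in> borel_measurable M"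
    using g by (intro borel_measurable_prod measurable_compose[OF borel_measurable_component borel_measurable_spline_space]) auto
  then have "(\<lambda>\<omega>. s (rand_vec N X \<omega>)) \<in> borel_measurable M"
    by (simp add: s rand_vec_component)
  with step.IH show ?case by simp
qed simp

text \<open>
  Expanding each factor of a product function in the \<open>\<psi>\<close> of its variable and multiplying out gives a
  combination of the products indexed by all multi-indices. The factors agree with their expansions
  on the half-open intervals only, hence almost surely.
\<close>

lemma tensor_spline_expansion:
  assumes "s \<in> tensor_spline_space N p n \<xi>"
  shows "\<exists>c. AE \<omega> in M. s (rand_vec N X \<omega>) = (\<Sum>i\<in>full_index_set. c i * \<Psi> {1..N} i (rand_vec N X \<omega>))"
  using assms unfolding tensor_spline_space_def
proof (induction rule: fun_space.span_induct_alt)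
  case base
  show ?case by (intro exI[of _ "\<lambda>_. 0"]) simp
next
  case (step d s t)
  then obtain g where s: "s = (\<lambda>x. \<Prod>k\<in>{1..N}. g k (x k))"
      and g: "\<forall>k\<in>{1..N}. g k \<in> spline_space (p k) (n k) (\<xi> k)"
    by auto
  have "\<forall>k\<in>{1..N}. \<exists>e. \<forall>t\<in>{a k..<b k}. g k t = (\<Sum>i = 1..n k. e i * \<psi> k i t)"
    using g spline_variable.spline_eq_ortho_spline_combination[OF marginal] by blast
  then obtain e where e: "\<forall>k\<in>{1..N}. \<forall>t\<in>{a k..<b k}. g k t = (\<Sum>i = 1..n k. e k i * \<psi> k i t)"
    by metis
  have s_exp: "AE \<omega> in M. s (rand_vec N X \<omega>)
      = (\<Sum>i\<in>full_index_set. (\<Prod>k\<in>{1..N}. e k (i k)) * \<Psi> {1..N} i (rand_vec N X \<omega>))"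
    using AE_components_half_open
  proof eventually_elim
    case (elim \<omega>)
    have "s (rand_vec N X \<omega>) = (\<Prod>k\<in>{1..N}. \<Sum>i = 1..n k. e k i * \<psi> k i (X k \<omega>))"
      unfolding s using e elim by (intro prod.cong refl) (simp add: rand_vec_component)
    also have "\<dots> = (\<Sum>i\<in>full_index_set. \<Prod>k\<in>{1..N}. e k (i k) * \<psi> k (i k) (X k \<omega>))"
      by (rule prod_sum_PiE) auto
    finally show ?case by (simp add: prod.distrib multi_ortho_spline_rand_vec)
  qed
  from step.IH obtain c where
    "AE \<omega> in M. t (rand_vec N X \<omega>) = (\<Sum>i\<in>full_index_set. c i * \<Psi> {1..N} i (rand_vec N X \<omega>))" by blast
  with s_exp have "AE \<omega> in M. ((\<lambda>x. d * s x) + t) (rand_vec N X \<omega>)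
      = (\<Sum>i\<in>full_index_set. (d * (\<Prod>k\<in>{1..N}. e k (i k)) + c i) * \<Psi> {1..N} i (rand_vec N X \<omega>))"
    by eventually_elim (simp add: distrib_right sum.distrib sum_distrib_left mult.assoc)
  then show ?case by (rule exI[of _ "\<lambda>i. d * (\<Prod>k\<in>{1..N}. e k (i k)) + c i"])
qed

text \<open>
  The products themselves need not belong to the tensor-product space: \<open>\<psi>\<^sub>1 = 1\<close> is not a spline,
  as splines vanish at the right endpoint. Each \<open>\<psi>\<close> is replaced
      by a spline that agrees with it on the half-open interval.
\<close>

lemma tensor_spline_contains:
  "\<exists>s\<in>tensor_spline_space N p n \<xi>.
    AE \<omega> in M. (\<Sum>i\<in>full_index_set. c i * \<Psi> {1..N} i (rand_vec N X \<omega>)) = s (rand_vec N X \<omega>)"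
proof -
  have "\<forall>k i. k \<in> {1..N} \<and> i \<in> {1..n k} \<longrightarrow>
      (\<exists>g. g \<in> spline_space (p k) (n k) (\<xi> k) \<and> (\<forall>t\<in>{a k..<b k}. \<psi> k i t = g t))"
    using spline_variable.ortho_spline_eq_spline[OF marginal] by blast
  then obtain g where g: "\<And>k i. k \<in> {1..N} \<Longrightarrow> i \<in> {1..n k} \<Longrightarrow> g k i \<in> spline_space (p k) (n k) (\<xi> k)"
    "\<And>k i t. k \<in> {1..N} \<Longrightarrow> i \<in> {1..n k} \<Longrightarrow> t \<in> {a k..<b k} \<Longrightarrow> \<psi> k i t = g k i t"
    by metis
  define s where "s x = (\<Sum>i\<in>full_index_set. c i * (\<Prod>k\<in>{1..N}. g k (i k) (x k)))" for x
  have "s \<in> tensor_spline_space N p n \<xi>"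
    unfolding tensor_spline_space_def s_def
  proof (intro linear_combination_in_span fun_space.span_base CollectI)
    fix i assume i: "i \<in> full_index_set"
    have "\<forall>k\<in>{1..N}. g k (i k) \<in> spline_space (p k) (n k) (\<xi> k)"
      using PiE_mem[OF i] by (intro ballI g(1))
    then show "\<exists>h. (\<lambda>x. \<Prod>k\<in>{1..N}. g k (i k) (x k)) = (\<lambda>x. \<Prod>k\<in>{1..N}. h k (x k)) \<and>
        (\<forall>k\<in>{1..N}. h k \<in> spline_space (p k) (n k) (\<xi> k))"
      by (intro exI[of _ "\<lambda>k. g k (i k)"]) simp
  qed
  moreover have "AE \<omega> in M. (\<Sum>i\<in>full_index_set. c i * \<Psi> {1..N} i (rand_vec N X \<omega>)) = s (rand_vec N X \<omega>)"
    using AE_components_half_open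
  proof eventually_elim
    case (elim \<omega>)
    have "(\<Prod>k\<in>{1..N}. \<psi> k (i k) (X k \<omega>)) = (\<Prod>k\<in>{1..N}. g k (i k) (X k \<omega>))" if "i \<in> full_index_set" for i
      using that elim by (intro prod.cong refl g(2)) (auto dest: PiE_mem)
    then show ?case by (simp add: s_def multi_ortho_spline_rand_vec rand_vec_component)
  qed
  ultimately show ?thesis by blast
qed

lemma orthonormal_full_products:
  "orthonormal_family M full_index_set (\<lambda>i \<omega>. \<Psi> {1..N} i (rand_vec N X \<omega>))
    {(\<lambda>\<omega>. s (rand_vec N X \<omega>)) | s. s \<in> tensor_spline_space N p n \<xi>}"
proof
  show "finite full_index_set" by (intro finite_PiE) auto
next
  fix s assume "s \<in> {(\<lambda>\<omega>. s (rand_vec N X \<omega>)) | s. s \<in> tensor_spline_space N p n \<xi>}"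
  then obtain t where t: "t \<in> tensor_spline_space N p n \<xi>" and s: "s = (\<lambda>\<omega>. t (rand_vec N X \<omega>))"
      by blast
  show "s \<in> borel_measurable M" unfolding s by (rule tensor_spline_measurable[OF t])
  show "\<exists>c. AE \<omega> in M. s \<omega> = (\<Sum>i\<in>full_index_set. c i * \<Psi> {1..N} i (rand_vec N X \<omega>))"
    unfolding s by (rule tensor_spline_expansion[OF t])
next
  fix c
  obtain t where "t \<in> tensor_spline_space N p n \<xi>"
    "AE \<omega> in M. (\<Sum>i\<in>full_index_set. c i * \<Psi> {1..N} i (rand_vec N X \<omega>)) = t (rand_vec N X \<omega>)"
    using tensor_spline_contains by blast
  then show "\<exists>s\<in>{(\<lambda>\<omega>. s (rand_vec N X \<omega>)) | s. s \<in> tensor_spline_space N p n \<xi>}.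
      AE \<omega> in M. (\<Sum>i\<in>full_index_set. c i * \<Psi> {1..N} i (rand_vec N X \<omega>)) = s \<omega>"
    by (intro bexI[of _ "\<lambda>\<omega>. t (rand_vec N X \<omega>)"]) auto
qed (rule full_product_square_integrable full_products_orthonormal; assumption)+

lemma expectation_eq_box_integral:
  assumes h: "h \<in> borel_measurable (box_borel N a b)"
  shows "expectation (\<lambda>\<omega>. h (rand_vec N X \<omega>))
    = (LINT x:box_set N a b|(\<Pi>\<^sub>M k\<in>{1..N}. lborel). h x * joint_density N f x)"
proof -
  \<comment> \<open>\<open>h\<close> is measurable on the box only, so it is extended by zero.\<close>
  define g where "g x = indicator (box_set N a b) x * h x" for x
  have box: "box_set N a b \<in> sets (\<Pi>\<^sub>M k\<in>{1..N}. borel)"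
    unfolding box_set_def by (intro sets_PiM_I_finite) auto
  have sets_eq: "sets (\<Pi>\<^sub>M k\<in>{1..N}. lborel) = sets (\<Pi>\<^sub>M k\<in>{1..N}. (borel :: real measure))"
    by (rule sets_PiM_cong) auto
  have "g \<in> borel_measurable (\<Pi>\<^sub>M k\<in>{1..N}. borel)"
    using h box unfolding box_borel_def g_def
    by (subst (asm) borel_measurable_restrict_space_iff) (auto simp: sets.Int_space_eq2)
  then have g: "g \<in> borel_measurable (\<Pi>\<^sub>M k\<in>{1..N}. lborel)"
    by (subst measurable_cong_sets[OF sets_eq refl])
  have dist: "distributed M (\<Pi>\<^sub>M k\<in>{1..N}. lborel) (rand_vec N X) (\<lambda>x. ennreal (joint_density N f x))"
    unfolding joint_density_def rand_vec_def[abs_def] using N_pos indep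
    by (intro distributed_joint_density spline_variable.density[OF marginal]
        spline_variable.density_nonneg[OF marginal]) auto
  have "(\<integral>x. joint_density N f x * g x \<partial>(\<Pi>\<^sub>M k\<in>{1..N}. lborel)) = expectation (\<lambda>\<omega>. g (rand_vec N X \<omega>))"
    using spline_variable.density_nonneg[OF marginal]
    by (intro distributed_integral[OF dist g]) (auto simp: joint_density_def intro!: prod_nonneg)
  also have "\<dots> = expectation (\<lambda>\<omega>. h (rand_vec N X \<omega>))"
  proof (rule Bochner_Integration.integral_cong[OF refl])
    fix \<omega> assume "\<omega> \<in> space M"
    then have "rand_vec N X \<omega> \<in> box_set N a b"
      using spline_variable.range[OF marginal] by (auto simp: rand_vec_def box_set_def)
    then show "g (rand_vec N X \<omega>) = h (rand_vec N X \<omega>)" by (simp add: g_def)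
  qed
  finally show ?thesis by (simp add: set_lebesgue_integral_def g_def mult_ac)
qed

lemma multi_ortho_spline_box_measurable:
  assumes "u \<subseteq> {1..N}" "i \<in> reduced_index_set n u"
  shows "\<Psi> u i \<in> borel_measurable (box_borel N a b)"
  unfolding box_borel_def
proof (rule measurable_restrict_space1)
  have "(\<lambda>x. \<psi> k (i k) (x k)) \<in> borel_measurable (\<Pi>\<^sub>M k\<in>{1..N}. borel)" if "k \<in> u" for k
  proof -
    have k: "k \<in> {1..N}" using assms that by blast
    have "i k \<in> {1..n k}" using assms that by (force simp: reduced_index_set_def PiE_iff)
    then show ?thesis
      by (rule measurable_compose[OF measurable_component_singleton[OF k] borel_measurable_ortho_spline[OF k]])
  qed
  then show "\<Psi> u i \<in> borel_measurable (\<Pi>\<^sub>M k\<in>{1..N}. borel)"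
    unfolding multi_ortho_spline_def[abs_def] by (intro borel_measurable_prod)
qed

end

section \<open>The spline dimensional decomposition\<close>

theorem theorem5p1:
  fixes M :: "'w measure"
    and N :: nat
    and a b :: "nat \<Rightarrow> real"
    and X :: "nat \<Rightarrow> 'w \<Rightarrow> real"
    and f :: "nat \<Rightarrow> real \<Rightarrow> real"
    and p n :: "nat \<Rightarrow> nat"
    and \<xi> :: "nat \<Rightarrow> nat \<Rightarrow> real"
    and y :: "(nat \<Rightarrow> real) \<Rightarrow> real"
  assumes "prob_space M"
    and "1 \<le> N"
    and "\<forall>k\<in>{1..N}. a k < b k"
    and "\<forall>k\<in>{1..N}. \<forall>\<omega>\<in>space M. X k \<omega> \<in> {a k..b k}"
    and "prob_space.indep_vars M (\<lambda>_. borel) X {1..N}"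
    and "\<forall>k\<in>{1..N}. (\<forall>x. 0 \<le> f k x) \<and> distributed M lborel (X k) (\<lambda>x. ennreal (f k x))"
    and "\<forall>k\<in>{1..N}. continuous_on {a k..b k} (f k) \<and> closure {x. f k x \<noteq> 0} = {a k..b k}"
    and "\<forall>k\<in>{1..N}. open_knot_sequence (p k) (n k) (a k) (b k) (\<xi> k)"
    and "y \<in> borel_measurable (box_borel N a b)"
    and "square_integrable M (\<lambda>\<omega>. y (rand_vec N X \<omega>))"
  shows "let
      Y = (\<lambda>\<omega>. y (rand_vec N X \<omega>));
      V = {(\<lambda>\<omega>. s (rand_vec N X \<omega>)) | s. s \<in> tensor_spline_space N p n \<xi>};
      \<Psi> = multi_ortho_spline M X p n \<xi>;
      y0 = prob_space.expectation M Y;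
      C = (\<lambda>u i. prob_space.expectation M (\<lambda>\<omega>. Y \<omega> * \<Psi> u i (rand_vec N X \<omega>)));
      Y_SDD = (\<lambda>\<omega>. y0 + (\<Sum>u\<in>Pow {1..N} - {{}}. \<Sum>i\<in>reduced_index_set n u.
                  C u i * \<Psi> u i (rand_vec N X \<omega>)))
    in
      is_orth_projection M V Y Y_SDD \<and>
      (\<forall>Z. is_orth_projection M V Y Z \<longrightarrow> (AE \<omega> in M. Z \<omega> = Y_SDD \<omega>)) \<and>
      integrable M Y \<and>
      y0 = (LINT x:box_set N a b|(\<Pi>\<^sub>M k\<in>{1..N}. lborel). y x * joint_density N f x) \<and>
      (\<forall>u\<in>Pow {1..N} - {{}}. \<forall>i\<in>reduced_index_set n u.
         integrable M (\<lambda>\<omega>. Y \<omega> * \<Psi> u i (rand_vec N X \<omega>)) \<and>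
         C u i = (LINT x:box_set N a b|(\<Pi>\<^sub>M k\<in>{1..N}. lborel). y x * \<Psi> u i x * joint_density N f x))"
proof -
  interpret spline_vector M N X f a b p n \<xi>
    using assms by (intro spline_vector.intro spline_vector_axioms.intro spline_variable.intro
        spline_variable_axioms.intro) auto
  define Y where "Y \<omega> = y (rand_vec N X \<omega>)" for \<omega>
  define V where "V = {(\<lambda>\<omega>. s (rand_vec N X \<omega>)) | s. s \<in> tensor_spline_space N p n \<xi>}"
  define C where "C u i = expectation (\<lambda>\<omega>. Y \<omega> * \<Psi> u i (rand_vec N X \<omega>))" for u i
  define Z where "Z \<omega> = expectation Y + (\<Sum>u\<in>Pow {1..N} - {{}}. \<Sum>i\<in>reduced_index_set n u.
      C u i * \<Psi> u i (rand_vec N X \<omega>))" for \<omega>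
  interpret orthonormal_family M full_index_set "\<lambda>i \<omega>. \<Psi> {1..N} i (rand_vec N X \<omega>)" V
    unfolding V_def by (rule orthonormal_full_products)
  have Y: "square_integrable M Y" using assms(10) by (simp add: Y_def[abs_def])
  have Z_eq: "Z \<omega> = (\<Sum>i\<in>full_index_set. expectation (\<lambda>\<omega>. Y \<omega> * \<Psi> {1..N} i (rand_vec N X \<omega>)) * \<Psi> {1..N} i (rand_vec N X \<omega>))" for \<omega>
    unfolding Z_def C_def
    by (subst sum_full_index_set[of "\<lambda>\<Phi>. expectation (\<lambda>\<omega>. Y \<omega> * \<Phi> (rand_vec N X \<omega>)) * \<Phi> (rand_vec N X \<omega>)"]) simp
  have proj: "is_orth_projection M V Y Z"
    unfolding Z_eq[abs_def] by (rule fourier_sum_is_orth_projection[OF Y])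
  have unique: "AE \<omega> in M. Z' \<omega> = Z \<omega>" if "is_orth_projection M V Y Z'" for Z'
    unfolding Z_eq by (rule orth_projection_unique[OF Y that])
  have intY: "integrable M Y"
    using square_integrable_mult[OF Y, of "\<lambda>_. 1"] by (simp add: square_integrable_def)
  have y0: "expectation Y = (LINT x:box_set N a b|(\<Pi>\<^sub>M k\<in>{1..N}. lborel). y x * joint_density N f x)"
    unfolding Y_def by (rule expectation_eq_box_integral[OF assms(9)])
  have coeff: "integrable M (\<lambda>\<omega>. Y \<omega> * \<Psi> u i (rand_vec N X \<omega>)) \<and>
      C u i = (LINT x:box_set N a b|(\<Pi>\<^sub>M k\<in>{1..N}. lborel). y x * \<Psi> u i x * joint_density N f x)"
    if u: "u \<in> Pow {1..N} - {{}}" and i: "i \<in> reduced_index_set n u" for u i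
  proof
    have u': "u \<subseteq> {1..N}" using u by blast
    show "integrable M (\<lambda>\<omega>. Y \<omega> * \<Psi> u i (rand_vec N X \<omega>))"
      by (rule square_integrable_mult[OF Y full_product_square_integrable[OF extend_index_in_full[OF u' i],
            unfolded multi_ortho_spline_extend_index[OF u']]])
    show "C u i = (LINT x:box_set N a b|(\<Pi>\<^sub>M k\<in>{1..N}. lborel). y x * \<Psi> u i x * joint_density N f x)"
      unfolding C_def Y_def
      by (rule expectation_eq_box_integral[OF borel_measurable_times[OF assms(9) multi_ortho_spline_box_measurable[OF u' i]]])
  qed
  show ?thesis
    using proj unique intY y0 coeff
    unfolding Let_def V_def Z_def[abs_def] C_def Y_def[abs_def] by blast
qed

end
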